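(* Let $(Q,\lhd)$ be a quandle, $A$ an abelian group, and $\omega\colon Q\times Q\to A$ a positive quandle $2$-cocycle. Regard $\mathbb{Z}_2=\mathbb{Z}/2\mathbb{Z}$ as a $Q$-module via $m\lhd a=m+1$, and let $\omega_{-1}\colon\mathbb{Z}_2\times Q\times Q\to A$, $\omega_{-1}(m,a,b)=(-1)^m\omega(a,b)$. Then for every knot diagram $D$, the multiset $\{\,\mathcal{W}^{pos}_\omega(D,\mathcal{C})\mid\mathcal{C}\in\mathscr{C}_Q(D)\,\}$ of positive $\omega$-weights of $D$ coincides with the multiset $$\{\,\mathcal{W}^{sh}_{\omega_{-1}}(D,\mathcal{C},\mathcal{C}^{sh})\mid(\mathcal{C},\mathcal{C}^{sh})\in\mathscr{C}^{sh}_{Q,\mathbb{Z}_2}(D),\ \mathcal{C}^{sh}(\Delta_{ex}(D))=0\,\}$$ of its $\mathbb{Z}_2$-shadow $\omega_{-1}$-weights with the exterior region colored by $0$.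
   Context: Quandle: a set $Q$ with operations $\lhd,\widetilde{\lhd}$ such that $(a\lhd b)\lhd c=(a\lhd c)\lhd(b\lhd c)$, $(a\lhd b)\,\widetilde{\lhd}\,b=(a\,\widetilde{\lhd}\,b)\lhd b=a$, $a\lhd a=a$ for all $a,b,c\in Q$. A $Q$-module is a set $M$ with maps $\lhd,\widetilde{\lhd}\colon M\times Q\to M$ satisfying $(m\lhd b)\lhd c=(m\lhd c)\lhd(b\lhd c)$ and $(m\lhd b)\,\widetilde{\lhd}\,b=(m\,\widetilde{\lhd}\,b)\lhd b=m$ for $m\in M$, $b,c\in Q$. Knots: "knot" means oriented knot or link in $\mathbb{R}^3$; a knot diagram $D$ is a diagram in $\mathbb{R}^2$ of such a link. Arcs run from undercrossing to undercrossing (or are closed curves). Regions are the connected components of $\mathbb{R}^2\setminus D$; $\Delta_{ex}(D)$ is the exterior (unbounded) region. Left and right of an oriented arc are as seen when travelling along it. Colorings: a $Q$-coloring $\mathcal{C}$ of $D$ assigns an element of $Q$ to each arc such that at each crossing, if the over-arc has color $b$ and the under-arc on the right of the over-arc has color $a$, then the under-arc on the left of the over-arc has color $a\lhd b$. The set of $Q$-colorings is $\mathscr{C}_Q(D)$. A (shadow) $(Q,M)$-coloring is a pair $(\mathcal{C},\mathcal{C}^{sh})$ with $\mathcal{C}\in\mathscr{C}_Q(D)$ and $\mathcal{C}^{sh}$ an assignment of elements of $M$ to regions such that whenever the region on the right of an arc colored $a$ has color $m$, the adjacent region on its left has color $m\lhd a$. The set of these is $\mathscr{C}^{sh}_{Q,M}(D)$.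 Weights: for a crossing $x$, $\varepsilon(x)=\pm1$ is its usual sign, $b_x$ is the color of the over-arc, $a_x$ the color of the under-arc lying on the right of the over-arc, and the source region $\Delta(x)$ is the one of the four regions at $x$ lying on the right of both strands. For $\phi\colon M\times Q\times Q\to A$ the shadow $\phi$-weight is $\mathcal{W}^{sh}_\phi(D,\mathcal{C},\mathcal{C}^{sh})=\sum_x\varepsilon(x)\,\phi(\mathcal{C}^{sh}(\Delta(x)),a_x,b_x)$. The positive $\omega$-weight is $\mathcal{W}^{pos}_\omega(D,\mathcal{C})=\sum_x\varepsilon^{pos}(x)\,\omega(a_x,b_x)$. Here one takes the checkerboard (black/white) coloring of the regions of $D$ with $\Delta_{ex}(D)$ white, and $\varepsilon^{pos}(x)=+1$ if the two regions swept by rotating the over-strand at $x$ counterclockwise until it meets the under-strand are black, $\varepsilon^{pos}(x)=-1$ if they are white. Sums are over all crossings. A positive quandle $2$-cocycle is a map $\omega\colon Q\times Q\to A$ with $\omega(a,a)=0$ and $\omega(a,c)+\omega(a\lhd b,c)=\omega(a\lhd c,b\lhd c)+\omega(a,b)+2\omega(b,c)$ for all $a,b,c\in Q$. Two multisets given as indexed families coincide if there is a bijection of index sets preserving values. *)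

theory Defs
  imports "HOL-Analysis.Analysis" "HOL-Library.Z2"
begin

section \<open>Quandles, modules and cocycles\<close>

locale quandle =
  fixes Q :: "'q set"
    and tri :: "'q \<Rightarrow> 'q \<Rightarrow> 'q"  (infixl \<open>\<lhd>\<close> 70)
    and tri_inv :: "'q \<Rightarrow> 'q \<Rightarrow> 'q"  (infixl \<open>\<lhd>\<inverse>\<close> 70)
  assumes tri_closed: "\<lbrakk>a \<in> Q; b \<in> Q\<rbrakk> \<Longrightarrow> a \<lhd> b \<in> Q"
    and tri_inv_closed: "\<lbrakk>a \<in> Q; b \<in> Q\<rbrakk> \<Longrightarrow> a \<lhd>\<inverse> b \<in> Q"
    and self_distrib: "\<lbrakk>a \<in> Q; b \<in> Q; c \<in> Q\<rbrakk> \<Longrightarrow> (a \<lhd> b) \<lhd> c = (a \<lhd> c) \<lhd> (b \<lhd> c)"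
    and tri_tri_inv: "\<lbrakk>a \<in> Q; b \<in> Q\<rbrakk> \<Longrightarrow> (a \<lhd> b) \<lhd>\<inverse> b = a"
    and tri_inv_tri: "\<lbrakk>a \<in> Q; b \<in> Q\<rbrakk> \<Longrightarrow> (a \<lhd>\<inverse> b) \<lhd> b = a"
    and idem: "a \<in> Q \<Longrightarrow> a \<lhd> a = a"

locale quandle_module = quandle Q tri tri_inv
  for Q :: "'q set" and tri (infixl \<open>\<lhd>\<close> 70) and tri_inv (infixl \<open>\<lhd>\<inverse>\<close> 70) +
  fixes M :: "'m set"
    and act :: "'m \<Rightarrow> 'q \<Rightarrow> 'm"  (infixl \<open>\<cdot>\<close> 70)
    and act_inv :: "'m \<Rightarrow> 'q \<Rightarrow> 'm"  (infixl \<open>\<cdot>\<inverse>\<close> 70)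
  assumes act_closed: "\<lbrakk>m \<in> M; b \<in> Q\<rbrakk> \<Longrightarrow> m \<cdot> b \<in> M"
    and act_inv_closed: "\<lbrakk>m \<in> M; b \<in> Q\<rbrakk> \<Longrightarrow> m \<cdot>\<inverse> b \<in> M"
    and act_distrib: "\<lbrakk>m \<in> M; b \<in> Q; c \<in> Q\<rbrakk> \<Longrightarrow> (m \<cdot> b) \<cdot> c = (m \<cdot> c) \<cdot> (b \<lhd> c)"
    and act_act_inv: "\<lbrakk>m \<in> M; b \<in> Q\<rbrakk> \<Longrightarrow> (m \<cdot> b) \<cdot>\<inverse> b = m"
    and act_inv_act: "\<lbrakk>m \<in> M; b \<in> Q\<rbrakk> \<Longrightarrow> (m \<cdot>\<inverse> b) \<cdot> b = m"

definition Z2_act :: "bit \<Rightarrow> 'q \<Rightarrow> bit" where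
  "Z2_act m a = m + 1"

lemma (in quandle) quandle_module_Z2:
  "quandle_module Q tri tri_inv UNIV Z2_act Z2_act"
  by unfold_locales (simp_all add: Z2_act_def add.assoc)

definition positive_quandle_2cocycle ::
    "'q set \<Rightarrow> ('q \<Rightarrow> 'q \<Rightarrow> 'q) \<Rightarrow> ('q \<Rightarrow> 'q \<Rightarrow> 'a::ab_group_add) \<Rightarrow> bool" where
  "positive_quandle_2cocycle Q tri \<omega> \<longleftrightarrow>
     (\<forall>a\<in>Q. \<omega> a a = 0) \<and>
     (\<forall>a\<in>Q. \<forall>b\<in>Q. \<forall>c\<in>Q.
        \<omega> a c + \<omega> (tri a b) c
          = \<omega> (tri a c) (tri b c) + \<omega> a b + (\<omega> b c + \<omega> b c))"

definition omega_minus_one ::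
    "('q \<Rightarrow> 'q \<Rightarrow> 'a::ab_group_add) \<Rightarrow> bit \<Rightarrow> 'q \<Rightarrow> 'q \<Rightarrow> 'a" where
  "omega_minus_one \<omega> m a b = (if m = 0 then \<omega> a b else - \<omega> a b)"


section \<open>Oriented link diagrams in the plane\<close>

text \<open>
  A diagram is a \<open>C\<^sup>1\<close> immersion of finitely many oriented circles into the plane
  (identified with \<^typ>\<open>complex\<close>), whose only multiple points are finitely many
  transverse double points, together with the choice of the lower strand at each of
  them. A point of the parameter space is a pair consisting of the index of a
  component and a point of the unit circle; the circle is oriented
  counterclockwise. The field \<open>under\<close> is the set of parameters at which the
  curve runs through an undercrossing.
\<close>

type_synonym param = "nat \<times> complex"

record diagram =
  ncomp :: nat
  curve :: "nat \<Rightarrow> complex \<Rightarrow> complex"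
  under :: "param set"

definition params :: "diagram \<Rightarrow> param set" where
  "params D = {..<ncomp D} \<times> sphere 0 1"

definition pos :: "diagram \<Rightarrow> param \<Rightarrow> complex" where
  "pos D p = curve D (fst p) (snd p)"

definition advance :: "param \<Rightarrow> real \<Rightarrow> param" where
  "advance p t = (fst p, snd p * cis t)"

definition velocity :: "diagram \<Rightarrow> param \<Rightarrow> complex" where
  "velocity D p = vector_derivative (\<lambda>t. pos D (advance p t)) (at 0)"

text \<open>
  The determinant of two plane vectors: \<open>cross u d > 0\<close> iff \<open>d\<close> points to the left
  of \<open>u\<close>, and \<open>cross u d < 0\<close> iff it points to the right.
\<close>

definition cross :: "complex \<Rightarrow> complex \<Rightarrow> real" where
  "cross u d = Re u * Im d - Im u * Re d"

text \<open>A crossing is the pair of its over-parameter and its under-parameter.\<close>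

definition crossings :: "diagram \<Rightarrow> (param \<times> param) set" where
  "crossings D = {(p, q). p \<in> params D \<and> q \<in> params D \<and> p \<noteq> q \<and> pos D p = pos D q \<and> q \<in> under D}"

definition link_diagram :: "diagram \<Rightarrow> bool" where
  "link_diagram D \<longleftrightarrow>
     (\<forall>i<ncomp D. (\<lambda>t. curve D i (cis t)) C1_differentiable_on UNIV) \<and>
     (\<forall>p\<in>params D. velocity D p \<noteq> 0) \<and>
     finite (crossings D) \<and>
     (\<forall>p\<in>params D. \<forall>q\<in>params D. \<forall>r\<in>params D.
        pos D p = pos D q \<and> pos D q = pos D r \<longrightarrow> p = q \<or> q = r \<or> p = r) \<and>
     (\<forall>p\<in>params D. \<forall>q\<in>params D. p \<noteq> q \<and> pos D p = pos D q \<longrightarrow>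
        cross (velocity D p) (velocity D q) \<noteq> 0 \<and> (p \<in> under D \<longleftrightarrow> q \<notin> under D)) \<and>
     (\<forall>p\<in>under D. p \<in> params D \<and> (\<exists>q\<in>params D. q \<noteq> p \<and> pos D q = pos D p))"

definition simple_params :: "diagram \<Rightarrow> param set" where
  "simple_params D = {p \<in> params D. \<forall>q\<in>params D. pos D q = pos D p \<longrightarrow> q = p}"


subsection \<open>Arcs\<close>

text \<open>
  Arcs are taken in the parameter space, so that they pass over overcrossings without
  interruption; the topology on \<^typ>\<open>nat\<close> is discrete.
\<close>

definition arcs :: "diagram \<Rightarrow> param set set" where
  "arcs D = components (params D - under D)"

definition arc_at :: "diagram \<Rightarrow> param \<Rightarrow> param set" where
  "arc_at D p = (THE A. A \<in> arcs D \<and> p \<in> A)"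

definition arc_before :: "diagram \<Rightarrow> param \<Rightarrow> param set" where
  "arc_before D q =
     (THE A. A \<in> arcs D \<and> (\<forall>\<^sub>F t in at_right 0. advance q (- t) \<in> A))"

definition arc_after :: "diagram \<Rightarrow> param \<Rightarrow> param set" where
  "arc_after D q =
     (THE A. A \<in> arcs D \<and> (\<forall>\<^sub>F t in at_right 0. advance q t \<in> A))"

fun over_arc :: "diagram \<Rightarrow> param \<times> param \<Rightarrow> param set" where
  "over_arc D (p, q) = arc_at D p"

text \<open>
  If the under-strand runs from right to left of the over-strand, its incoming arc lies on
  the right; otherwise its outgoing arc does.
\<close>

fun under_arc_right :: "diagram \<Rightarrow> param \<times> param \<Rightarrow> param set" where
  "under_arc_right D (p, q) =
     (if cross (velocity D p) (velocity D q) > 0 then arc_before D q else arc_after D q)"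

fun under_arc_left :: "diagram \<Rightarrow> param \<times> param \<Rightarrow> param set" where
  "under_arc_left D (p, q) =
     (if cross (velocity D p) (velocity D q) > 0 then arc_after D q else arc_before D q)"


subsection \<open>Regions\<close>

definition regions :: "diagram \<Rightarrow> complex set set" where
  "regions D = components (- (pos D ` params D))"

definition exterior_region :: "diagram \<Rightarrow> complex set" where
  "exterior_region D = (THE R. R \<in> regions D \<and> \<not> bounded R)"

text \<open>
  The region which, near the point \<open>x\<close>, is seen from \<open>x\<close> in all the directions in \<open>S\<close>.
\<close>

definition region_towards :: "diagram \<Rightarrow> complex \<Rightarrow> complex set \<Rightarrow> complex set" where
  "region_towards D x S =
     (THE R. R \<in> regions D \<and> (\<forall>d\<in>S. \<forall>\<^sub>F s in at_right 0. x + of_real s * d \<in> R))"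

definition left_region :: "diagram \<Rightarrow> param \<Rightarrow> complex set" where
  "left_region D p = region_towards D (pos D p) {d. cross (velocity D p) d > 0}"

definition right_region :: "diagram \<Rightarrow> param \<Rightarrow> complex set" where
  "right_region D p = region_towards D (pos D p) {d. cross (velocity D p) d < 0}"

fun source_region :: "diagram \<Rightarrow> param \<times> param \<Rightarrow> complex set" where
  "source_region D (p, q) =
     region_towards D (pos D p) {d. cross (velocity D p) d < 0 \<and> cross (velocity D q) d < 0}"

text \<open>
  The directions swept when the ray \<open>u\<close> is rotated counterclockwise until it becomes
  parallel to \<open>v\<close>. The over-strand at a crossing consists of the two rays \<open>u\<close> and \<open>- u\<close>,
  where \<open>u\<close> is its velocity, and hence sweeps two opposite sectors.
\<close>

definition swept :: "complex \<Rightarrow> complex \<Rightarrow> complex set" where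
  "swept u v = {cis \<theta> * u | \<theta>. 0 < \<theta> \<and> (\<forall>\<eta>\<in>{0<..\<theta>}. cross (cis \<eta> * u) v \<noteq> 0)}"

fun swept_regions :: "diagram \<Rightarrow> param \<times> param \<Rightarrow> complex set set" where
  "swept_regions D (p, q) =
     {region_towards D (pos D p) (swept (velocity D p) (velocity D q)),
      region_towards D (pos D p) (swept (- velocity D p) (velocity D q))}"

text \<open>\<open>B\<close> is the set of black regions of a checkerboard coloring with white exterior.\<close>

definition checkerboard :: "diagram \<Rightarrow> complex set set \<Rightarrow> bool" where
  "checkerboard D B \<longleftrightarrow>
     B \<subseteq> regions D \<and> exterior_region D \<notin> B \<and>
     (\<forall>p\<in>simple_params D. left_region D p \<in> B \<longleftrightarrow> right_region D p \<notin> B)"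

definition black_regions :: "diagram \<Rightarrow> complex set set" where
  "black_regions D = (THE B. checkerboard D B)"


section \<open>Colorings and weights\<close>

definition colorings ::
    "'q set \<Rightarrow> ('q \<Rightarrow> 'q \<Rightarrow> 'q) \<Rightarrow> diagram \<Rightarrow> (param set \<Rightarrow> 'q) set" where
  "colorings Q tri D =
     {C \<in> arcs D \<rightarrow>\<^sub>E Q.
        \<forall>x\<in>crossings D. C (under_arc_left D x) = tri (C (under_arc_right D x)) (C (over_arc D x))}"

definition shadow_colorings ::
    "'q set \<Rightarrow> ('q \<Rightarrow> 'q \<Rightarrow> 'q) \<Rightarrow> 'm set \<Rightarrow> ('m \<Rightarrow> 'q \<Rightarrow> 'm) \<Rightarrow> diagram \<Rightarrow>
     ((param set \<Rightarrow> 'q) \<times> (complex set \<Rightarrow> 'm)) set" where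
  "shadow_colorings Q tri M act D =
     {(C, S). C \<in> colorings Q tri D \<and> S \<in> regions D \<rightarrow>\<^sub>E M \<and>
        (\<forall>p\<in>simple_params D. S (left_region D p) = act (S (right_region D p)) (C (arc_at D p)))}"

fun crossing_sign :: "diagram \<Rightarrow> param \<times> param \<Rightarrow> int" where
  "crossing_sign D (p, q) = (if cross (velocity D p) (velocity D q) > 0 then 1 else - 1)"

definition pos_sign :: "diagram \<Rightarrow> param \<times> param \<Rightarrow> int" where
  "pos_sign D x = (if swept_regions D x \<subseteq> black_regions D then 1 else - 1)"

text \<open>Multiplication of an element of an abelian group by a sign \<open>1\<close> or \<open>- 1\<close>.\<close>

definition signed :: "int \<Rightarrow> 'a::ab_group_add \<Rightarrow> 'a" where
  "signed e a = (if e = 1 then a else - a)"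

definition shadow_weight ::
    "('m \<Rightarrow> 'q \<Rightarrow> 'q \<Rightarrow> 'a::ab_group_add) \<Rightarrow> diagram \<Rightarrow>
     (param set \<Rightarrow> 'q) \<Rightarrow> (complex set \<Rightarrow> 'm) \<Rightarrow> 'a" where
  "shadow_weight \<phi> D C S =
     (\<Sum>x\<in>crossings D. signed (crossing_sign D x)
        (\<phi> (S (source_region D x)) (C (under_arc_right D x)) (C (over_arc D x))))"

definition positive_weight ::
    "('q \<Rightarrow> 'q \<Rightarrow> 'a::ab_group_add) \<Rightarrow> diagram \<Rightarrow> (param set \<Rightarrow> 'q) \<Rightarrow> 'a" where
  "positive_weight \<omega> D C =
     (\<Sum>x\<in>crossings D. signed (pos_sign D x) (\<omega> (C (under_arc_right D x)) (C (over_arc D x))))"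

text \<open>
  Equality of the multisets \<open>{v i | i \<in> I}\<close> and \<open>{w j | j \<in> J}\<close>; the index sets may be
  infinite.
\<close>

definition same_multiset :: "'i set \<Rightarrow> ('i \<Rightarrow> 'a) \<Rightarrow> 'j set \<Rightarrow> ('j \<Rightarrow> 'a) \<Rightarrow> bool" where
  "same_multiset I v J w \<longleftrightarrow> (\<exists>f. bij_betw f I J \<and> (\<forall>i\<in>I. v i = w (f i)))"

end

(*
  The total winding number of the link around a point is constant on each region and vanishes on
  the exterior region. Near a point of the diagram every strand through it contributes one more
  to the winding number on its left than on its right. Hence the regions of odd winding number
  form a checkerboard coloring. It is the only one: two checkerboard colorings agree or disagree
  consistently across every simple point, and the plane without the finitely many crossings is
  connected.

  A Z/2-shadow coloring does not see the arc colors, so it amounts to a checkerboard coloring and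
  is determined by the color 0 of the exterior region. At a crossing of sign e, the two swept
  regions have the color of the source region if e = -1 and the opposite color if e = 1, so
  that (-1)^m e, with m the shadow color of the source region, is the positive sign. The
  weights therefore agree term by term.
*)

theory Submission
  imports Defs "HOL-Complex_Analysis.Complex_Analysis"
begin

section \<open>Winding numbers of plane paths near a point\<close>

text \<open>The main obstacle is the jump of the winding number across the diagram. A short piece of
  a strand is not closed, so its winding number need be neither an integer nor locally constant. But
  along a ray that leaves the strand transversally in direction \<open>d\<close>, the piece can be
  evaluated by a logarithm slit along that ray. For two rays \<open>d\<close> and \<open>d'\<close>
  the two values differ only by the branch of the logarithm, and the signs of \<open>cross\<close>
  at the endpoints identify the branch. This uses only the velocity of each strand at the point, so
  one jump formula serves both simple points and the sectors at a crossing.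

  A second obstacle is that \<open>region_towards\<close> sees a region only along rays, whose
  admissible length may shrink as the direction becomes tangent. Rays suffice to compare indices,
  but uniqueness of the coloring rests on connectedness and needs a full neighbourhood of each
  simple point. That neighbourhood is filled by short normal segments along the curve; they miss the
  rest of the curve because its tangential coordinate is strictly increasing.\<close>

lemma cross_add_left: "cross (u + w) d = cross u d + cross w d"
  and cross_add_right: "cross u (d + e) = cross u d + cross u e"
  and cross_scaleR_left: "cross (r *\<^sub>R u) d = r * cross u d"
  and cross_scaleR_right: "cross u (r *\<^sub>R d) = r * cross u d"
  and cross_minus_left: "cross (- u) d = - cross u d"
  and cross_minus_right: "cross u (- d) = - cross u d"
  and cross_commute: "cross d u = - cross u d"
  and cross_self: "cross u u = 0"
  and cross_zero_left: "cross 0 d = 0"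
  and cross_zero_right: "cross u 0 = 0"
  by (simp_all add: cross_def algebra_simps)

lemma abs_cross_le: "\<bar>cross u d\<bar> \<le> norm u * norm d"
proof -
  have "cross u d = Im (cnj u * d)" by (simp add: cross_def)
  then show ?thesis
    using abs_Im_le_cmod[of "cnj u * d"] by (simp add: norm_mult)
qed

lemma continuous_on_cross [continuous_intros]:
  assumes "continuous_on S f" "continuous_on S g"
  shows "continuous_on S (\<lambda>x. cross (f x) (g x))"
  unfolding cross_def by (intro continuous_intros assms)

lemma Im_divide_minus: "Im (w / (- d)) = cross w d / (norm d)\<^sup>2"
  by (simp add: cross_def Im_divide cmod_power2 diff_divide_distrib)

text \<open>To first order \<open>f t - f t0\<close> is \<open>(t - t0) *\<^sub>R v\<close>.
  Compactness of \<open>K\<close> bounds \<open>cross v d\<close> away from zero and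
  \<open>d\<close> from above, so one \<open>\<delta>\<close> makes the remainder harmless for all
  directions at once.\<close>

lemma cross_eventually_sgn:
  fixes f :: "real \<Rightarrow> complex"
  assumes f: "(f has_vector_derivative v) (at t0)"
    and K: "compact K" and nz: "\<And>d. d \<in> K \<Longrightarrow> cross v d \<noteq> 0"
  shows "\<exists>\<delta>>0. \<forall>t d. 0 < \<bar>t - t0\<bar> \<and> \<bar>t - t0\<bar> \<le> \<delta> \<and> d \<in> K \<longrightarrow>
           0 < cross (f t - f t0) d * cross v d * (t - t0)"
proof (cases "K = {}")
  case False
  have "continuous_on K (\<lambda>d. \<bar>cross v d\<bar>)" by (intro continuous_intros)
  then obtain d0 where d0: "d0 \<in> K" "\<And>d. d \<in> K \<Longrightarrow> \<bar>cross v d0\<bar> \<le> \<bar>cross v d\<bar>"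
    using continuous_attains_inf[OF K False, of "\<lambda>d. \<bar>cross v d\<bar>"] by auto
  define m where "m = \<bar>cross v d0\<bar>"
  have m: "m > 0" "\<And>d. d \<in> K \<Longrightarrow> m \<le> \<bar>cross v d\<bar>"
    using d0 nz[OF d0(1)] by (auto simp: m_def)
  obtain M where M: "M > 0" "\<And>d. d \<in> K \<Longrightarrow> norm d \<le> M"
    using compact_imp_bounded[OF K] by (auto simp: bounded_pos)
  \<comment> \<open>The remainder contributes at most \<open>e * M\<close> per unit of time, which
    is half of the smallest leading term \<open>m\<close>.\<close>
  define e where "e = m / (2 * M)"
  have e: "e > 0" "e * M < m" using m(1) M(1) by (auto simp: e_def)
  obtain \<delta> where \<delta>: "\<delta> > 0"
      "\<And>t. \<bar>t - t0\<bar> < \<delta> \<Longrightarrow> norm (f t - f t0 - (t - t0) *\<^sub>R v) \<le> e * \<bar>t - t0\<bar>"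
    using f e(1) unfolding has_vector_derivative_def has_derivative_at_alt by (auto simp: real_norm_def)
  have "0 < cross (f t - f t0) d * cross v d * (t - t0)"
    if t: "0 < \<bar>t - t0\<bar>" "\<bar>t - t0\<bar> \<le> \<delta> / 2" and d: "d \<in> K" for t d
  proof -
    define r where "r = f t - f t0 - (t - t0) *\<^sub>R v"
    have r: "norm r \<le> e * \<bar>t - t0\<bar>" using \<delta>(2)[of t] t \<delta>(1) unfolding r_def by simp
    have "\<bar>cross r d\<bar> \<le> norm r * norm d" by (rule abs_cross_le)
    also have "\<dots> \<le> (e * \<bar>t - t0\<bar>) * M"
      using r M(2)[OF d] e(1) by (intro mult_mono) auto
    also have "\<dots> = (e * M) * \<bar>t - t0\<bar>" by simp
    also have "\<dots> < m * \<bar>t - t0\<bar>" using e(2) t(1) by (rule mult_strict_right_mono)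
    also have "\<dots> \<le> \<bar>cross v d\<bar> * \<bar>t - t0\<bar>" using m(2)[OF d] by (rule mult_right_mono) simp
    finally have lt: "\<bar>cross r d\<bar> < \<bar>cross v d * (t - t0)\<bar>" by (simp add: abs_mult)
    have "f t - f t0 = (t - t0) *\<^sub>R v + r" by (simp add: r_def)
    then have "cross (f t - f t0) d = cross v d * (t - t0) + cross r d"
      by (simp add: cross_add_left cross_scaleR_left)
    moreover have "0 < (y + z) * y" if "\<bar>z\<bar> < \<bar>y\<bar>" for y z :: real
      using that by (cases "y > 0") (auto simp: zero_less_mult_iff)
    ultimately show ?thesis using lt by (simp add: mult.assoc)
  qed
  then show ?thesis using \<delta>(1) by (intro exI[of _ "\<delta> / 2"]) auto
qed (auto intro: exI[of _ 1])

text \<open>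
  The path avoids the ray from \<open>z\<close> in the direction \<open>d\<close>, on whose complement
  \<open>\<lambda>w. Ln ((w - z) / (- d))\<close> is a primitive of \<open>\<lambda>w. 1 / (w - z)\<close>.
\<close>

lemma winding_number_slit:
  assumes g: "valid_path g" and d: "d \<noteq> 0"
    and slit: "\<And>w. w \<in> path_image g \<Longrightarrow> (w - z) / (- d) \<notin> \<real>\<^sub>\<le>\<^sub>0"
  shows "winding_number g z =
    (Ln ((pathfinish g - z) / (- d)) - Ln ((pathstart g - z) / (- d))) / (2 * pi * \<i>)"
proof -
  have z: "z \<notin> path_image g" using slit[of z] by auto
  have "((\<lambda>w. 1 / (w - z)) has_contour_integral
          (Ln ((pathfinish g - z) / (- d)) - Ln ((pathstart g - z) / (- d)))) g"
  proof (rule contour_integral_primitive[OF _ g order_refl])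
    fix w assume w: "w \<in> path_image g"
    then have "w \<noteq> z" using z by auto
    then show "((\<lambda>w. Ln ((w - z) / (- d))) has_field_derivative 1 / (w - z)) (at w within path_image g)"
      using d slit[OF w] by (auto intro!: derivative_eq_intros simp: field_simps)
  qed
  then show ?thesis
    by (simp add: winding_number_valid_path[OF g z] contour_integral_unique)
qed

text \<open>Both differences of logarithms are logarithms of \<open>a / b\<close>, hence differ by
  \<open>2 * pi * \<i> * n\<close>. Since \<open>a\<close> and \<open>b\<close> lie on opposite
  sides of the line along \<open>d\<close>, the imaginary part lies in (0, 2 pi) or (- 2 pi, 0)
  according to the sign of \<open>cross a d\<close>; the same holds for \<open>d'\<close>. This
  confines the difference to an open interval of length 4 pi centred at a multiple of 2 pi, which
  determines \<open>n\<close>.\<close>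

lemma Ln_jump:
  fixes a b d d' :: complex
  assumes "(cross a d > 0 \<and> cross b d < 0) \<or> (cross a d < 0 \<and> cross b d > 0)"
    and "(cross a d' > 0 \<and> cross b d' < 0) \<or> (cross a d' < 0 \<and> cross b d' > 0)"
  shows "(Ln (a / (- d)) - Ln (b / (- d))) / (2 * pi * \<i>) - (Ln (a / (- d')) - Ln (b / (- d'))) / (2 * pi * \<i>)
     = of_bool (cross a d > 0) - of_bool (cross a d' > 0)"
proof -
  define L where "L = (\<lambda>d. Ln (a / (- d)) - Ln (b / (- d)))"
  have nz: "a \<noteq> 0" "b \<noteq> 0" "d \<noteq> 0" "d' \<noteq> 0"
    using assms by (auto simp: cross_zero_left cross_zero_right)
  have expL: "exp (L e) = a / b" if "e \<noteq> 0" for e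
    using that nz by (simp add: L_def exp_diff)
  have "exp (L d - L d') = 1" using nz by (simp add: exp_diff expL)
  then obtain n :: int where n: "Re (L d - L d') = 0" "Im (L d - L d') = of_int (2 * n) * pi"
    by (auto simp: exp_eq_1)
  have ImLn: "0 < Im (Ln (w / - e)) \<and> Im (Ln (w / - e)) < pi" if "cross w e > 0" for w e
  proof -
    have "e \<noteq> 0" "w \<noteq> 0" using that by (auto simp: cross_zero_left cross_zero_right)
    then have "Im (w / (- e)) > 0" using that unfolding Im_divide_minus by simp
    then show ?thesis by (rule Im_Ln_pos_lt_imp)
  qed
  have ImLn': "- pi < Im (Ln (w / - e)) \<and> Im (Ln (w / - e)) < 0" if "cross w e < 0" for w e
  proof -
    have "e \<noteq> 0" "w \<noteq> 0" using that by (auto simp: cross_zero_left cross_zero_right)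
    then have "Im (w / (- e)) < 0" using that unfolding Im_divide_minus by (simp add: divide_neg_pos)
    with \<open>e \<noteq> 0\<close> \<open>w \<noteq> 0\<close> show ?thesis
      using Im_Ln_pos_le[of "w / (-e)"] mpi_less_Im_Ln[of "w / (-e)"] Im_Ln_le_pi[of "w / (-e)"] by auto
  qed
  have pos: "0 < Im (L e) \<and> Im (L e) < 2 * pi" if "cross a e > 0" "cross b e < 0" for e
    using ImLn[OF that(1)] ImLn'[OF that(2)] by (auto simp: L_def)
  have neg: "- (2 * pi) < Im (L e) \<and> Im (L e) < 0" if "cross a e < 0" "cross b e > 0" for e
    using ImLn'[OF that(1)] ImLn[OF that(2)] by (auto simp: L_def)
  have n_eq: "n = k" if "2 * pi * (of_int k - 1) < Im (L d - L d')" "Im (L d - L d') < 2 * pi * (of_int k + 1)" for k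
  proof -
    have "Im (L d - L d') = 2 * pi * of_int n" using n(2) by simp
    then have "2 * pi * (of_int k - 1) < 2 * pi * of_int n" "2 * pi * of_int n < 2 * pi * (of_int k + 1)"
      using that by simp_all
    then have "of_int k - 1 < (of_int n :: real)" "(of_int n :: real) < of_int k + 1" by simp_all
    then show ?thesis by linarith
  qed
  have "n = of_bool (cross a d > 0) - of_bool (cross a d' > 0)"
    using assms pos[of d] neg[of d] pos[of d'] neg[of d']
    by (intro n_eq) (auto simp: algebra_simps)
  moreover have "L d - L d' = 2 * pi * \<i> * of_int n"
    using n by (simp add: complex_eq_iff)
  ultimately have "(L d - L d') / (2 * pi * \<i>) = of_bool (cross a d > 0) - of_bool (cross a d' > 0)"
    by simp
  then show ?thesis by (simp add: L_def diff_divide_distrib)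
qed

lemma tendsto_ray:
  fixes d :: complex
  shows "((\<lambda>s. x + of_real s * d) \<longlongrightarrow> x) (at_right 0)"
proof -
  have "((\<lambda>s. x + of_real s * d) \<longlongrightarrow> x + of_real 0 * d) (at_right 0)"
    by (intro tendsto_intros)
  then show ?thesis by simp
qed

text \<open>The piece meets the line through \<open>p t0\<close> in direction \<open>d\<close> only
  at \<open>p t0\<close>, which lies behind the ray starting at \<open>p t0 + of_real s * d\<close>.
  So the slit formula applies for every \<open>s > 0\<close>. The endpoints stay off the slit also
  for \<open>s = 0\<close>, and the formula is continuous there.\<close>

lemma winding_number_subpath_local:
  assumes p: "valid_path p" and ab: "0 \<le> a" "a < t0" "t0 < b" "b \<le> 1" and d: "d \<noteq> 0"
    and sgn: "\<And>t. t \<in> {a..b} \<Longrightarrow> t \<noteq> t0 \<Longrightarrow> cross (p t - p t0) d \<noteq> 0"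
  shows "((\<lambda>s. winding_number (subpath a b p) (p t0 + of_real s * d)) \<longlongrightarrow>
      (Ln ((p b - p t0) / (- d)) - Ln ((p a - p t0) / (- d))) / (2 * pi * \<i>)) (at_right 0)"
proof -
  let ?g = "subpath a b p"
  have g: "valid_path ?g" using ab by (intro valid_path_subpath p) auto
  have not_slit: "w / (- d) \<notin> \<real>\<^sub>\<le>\<^sub>0" if "cross w d \<noteq> 0" for w
  proof -
    have "Im (w / (- d)) \<noteq> 0" using that d unfolding Im_divide_minus by simp
    then show ?thesis by (auto simp: complex_nonpos_Reals_iff)
  qed
  \<comment> \<open>Moving the base point along the ray only adds a real number, so a nonzero
    imaginary part survives; at \<open>t = t0\<close> the quotient is \<open>s\<close> itself, which
    is positive.\<close>
  have shift: "(w - (x + of_real s * d)) / (- d) = (w - x) / (- d) + of_real s" for w x s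
    using d by (simp add: field_simps)
  have eq: "winding_number ?g (p t0 + of_real s * d) =
      (Ln ((p b - (p t0 + of_real s * d)) / (- d)) - Ln ((p a - (p t0 + of_real s * d)) / (- d))) / (2 * pi * \<i>)"
    if s: "s > 0" for s :: real
  proof -
    have "(w - (p t0 + of_real s * d)) / (- d) \<notin> \<real>\<^sub>\<le>\<^sub>0" if w: "w \<in> path_image ?g" for w
    proof -
      obtain t where t: "t \<in> {a..b}" "w = p t"
        using w ab by (auto simp: path_image_subpath)
      show ?thesis
      proof (cases "t = t0")
        case True
        then show ?thesis using s t d by (simp add: complex_nonpos_Reals_iff)
      next
        case False
        from sgn[OF t(1) False] have "Im ((p t - p t0) / (- d)) \<noteq> 0"
          using d unfolding Im_divide_minus by simp
        then have "Im ((w - (p t0 + of_real s * d)) / (- d)) \<noteq> 0"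
          unfolding shift t(2) by simp
        then show ?thesis by (auto simp: complex_nonpos_Reals_iff)
      qed
    qed
    from winding_number_slit[OF g d this] show ?thesis
      by (simp add: pathfinish_subpath pathstart_subpath)
  qed
  have "((\<lambda>s. (Ln ((p b - (p t0 + of_real s * d)) / (- d)) - Ln ((p a - (p t0 + of_real s * d)) / (- d))) / (2 * pi * \<i>)) \<longlongrightarrow>
      (Ln ((p b - p t0) / (- d)) - Ln ((p a - p t0) / (- d))) / (2 * pi * \<i>)) (at_right 0)"
    using ab d sgn[of a] sgn[of b] by (intro tendsto_intros tendsto_ray not_slit) auto
  then show ?thesis
    by (rule Lim_transform_eventually) (auto simp: eq eventually_at_right_less[THEN eventually_mono])
qed

text \<open>Each passage through \<open>x\<close> contributes 1 for \<open>d\<close> on its left and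
  1 less for \<open>d'\<close> on its left. The path is cut around one passage, where
  \<open>Ln_jump\<close> applies, and both remaining pieces have fewer passages. Without a passage
  the winding number is continuous at \<open>x\<close>, closed or not. The hypotheses
  \<open>avoid\<close> make the winding numbers of the pieces additive.\<close>

lemma winding_number_subpath_jump:
  assumes p: "valid_path p" and "b \<le> 1" and "p b \<noteq> x"
    and avoid: "\<forall>\<^sub>F s in at_right 0. x + of_real s * d \<notin> path_image p"
               "\<forall>\<^sub>F s in at_right 0. x + of_real s * d' \<notin> path_image p"
    and "0 \<le> a" "a \<le> b" "p a \<noteq> x"
    and "finite {t \<in> {a..b}. p t = x}"
    and "\<And>t. t \<in> {a..b} \<Longrightarrow> p t = x \<Longrightarrow> (p has_vector_derivative v t) (at t)"
    and "\<And>t. t \<in> {a..b} \<Longrightarrow> p t = x \<Longrightarrow> cross (v t) d \<noteq> 0 \<and> cross (v t) d' \<noteq> 0"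
  shows "((\<lambda>s. winding_number (subpath a b p) (x + of_real s * d) -
               winding_number (subpath a b p) (x + of_real s * d')) \<longlongrightarrow>
      (\<Sum>t | t \<in> {a..b} \<and> p t = x. of_bool (cross (v t) d > 0) - of_bool (cross (v t) d' > 0))) (at_right 0)"
  using assms(2,3,6-)
proof (induction "card {t \<in> {a..b}. p t = x}" arbitrary: a b rule: less_induct)
  case (less a b)
  define T where "T = {t \<in> {a..b}. p t = x}"
  have fin: "finite T" using less.prems unfolding T_def by auto
  show ?case
  proof (cases "T = {}")
    case True
    then have "x \<notin> path_image (subpath a b p)"
      using less.prems by (auto simp: T_def path_image_subpath)
    then have "isCont (winding_number (subpath a b p)) x"
      using less.prems p by (intro continuous_at_winding_number path_subpath valid_path_imp_path)  auto
    then have "((\<lambda>s. winding_number (subpath a b p) (x + of_real s * e)) \<longlongrightarrow>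
        winding_number (subpath a b p) x) (at_right 0)" for e
      by (intro isCont_tendsto_compose[OF _ tendsto_ray])
    from tendsto_diff[OF this[of d] this[of d']] show ?thesis
      unfolding T_def[symmetric] True by simp
  next
    case False
    define t0 where "t0 = Min T"
    have t0: "t0 \<in> T" "\<And>t. t \<in> T \<Longrightarrow> t0 \<le> t"
      using fin False by (auto simp: t0_def)
    then have t0T: "t0 \<in> {a..b}" "p t0 = x" by (auto simp: T_def)
    have "t0 \<noteq> a" "t0 \<noteq> b" using t0T less.prems by auto
    then have t0ab: "a < t0" "t0 < b" using t0T by auto
    have dv: "(p has_vector_derivative v t0) (at t0)"
      and cd: "cross (v t0) d \<noteq> 0" "cross (v t0) d' \<noteq> 0"
      using less.prems t0T by auto
    then have dnz: "d \<noteq> 0" "d' \<noteq> 0" by (auto simp: cross_zero_right)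
    obtain \<delta> where \<delta>: "\<delta> > 0" and "\<forall>t e. 0 < \<bar>t - t0\<bar> \<and> \<bar>t - t0\<bar> \<le> \<delta> \<and> e \<in> {d, d'} \<longrightarrow>
           0 < cross (p t - p t0) e * cross (v t0) e * (t - t0)"
      using cross_eventually_sgn[OF dv, of "{d, d'}"] cd by auto
    then have sgn: "0 < cross (p t - x) e * cross (v t0) e * (t - t0)"
      if "0 < \<bar>t - t0\<bar>" "\<bar>t - t0\<bar> \<le> \<delta>" "e \<in> {d, d'}" for t e
      using that t0T by auto
    have far: "p t \<noteq> x" if "0 < \<bar>t - t0\<bar>" "\<bar>t - t0\<bar> \<le> \<delta>" for t
      using sgn[OF that, of d] by (auto simp: cross_zero_left)
    \<comment> \<open>The window from \<open>u\<close> to \<open>w\<close> stays inside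
      \<open>{a..b}\<close> and inside the range where \<open>sgn\<close> holds, so
      \<open>t0\<close> is its only passage and its ends are not at \<open>x\<close>.\<close>
    define e where "e = min \<delta> (min (t0 - a) (b - t0))"
    define u w where "u = t0 - e" and "w = t0 + e"
    have e: "e > 0" "e \<le> \<delta>" "a \<le> u" "w \<le> b" "u < t0" "t0 < w"
      using \<delta> t0ab by (auto simp: e_def u_def w_def)
    have puw: "p u \<noteq> x" "p w \<noteq> x" using e far[of u] far[of w] by (auto simp: u_def w_def)
    let ?W = "\<lambda>y z s. winding_number (subpath y z p) (x + of_real s * d) - winding_number (subpath y z p) (x + of_real s * d')"
    let ?S = "\<lambda>y z. \<Sum>t | t \<in> {y..z} \<and> p t = x. of_bool (cross (v t) d > 0) - of_bool (cross (v t) d' > 0) :: complex"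
    have Tau: "{t \<in> {a..u}. p t = x} \<subseteq> T - {t0}" and Twb: "{t \<in> {w..b}. p t = x} \<subseteq> T - {t0}"
      using e by (auto simp: T_def)
    have card: "card {t \<in> {a..u}. p t = x} < card T" "card {t \<in> {w..b}. p t = x} < card T"
      using psubset_card_mono[OF fin] Tau Twb t0(1) by blast+
    have fin': "finite {t \<in> {a..u}. p t = x}" "finite {t \<in> {w..b}. p t = x}"
      using fin Tau Twb by (meson finite_Diff finite_subset)+
    have 1: "(?W a u \<longlongrightarrow> ?S a u) (at_right 0)"
      using less.prems e puw fin' by (intro less.hyps card[unfolded T_def]) auto
    have 3: "(?W w b \<longlongrightarrow> ?S w b) (at_right 0)"
      using less.prems e puw fin' by (intro less.hyps card[unfolded T_def]) auto
    have uw01: "0 \<le> u" "w \<le> 1" using e less.prems by auto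
    let ?L = "\<lambda>d. (Ln ((p w - x) / (- d)) - Ln ((p u - x) / (- d))) / (2 * pi * \<i>)"
    have lim: "((\<lambda>s. winding_number (subpath u w p) (x + of_real s * f)) \<longlongrightarrow> ?L f) (at_right 0)"
      if "f \<in> {d, d'}" for f
    proof -
      have "f \<noteq> 0" using that dnz by auto
      moreover have "cross (p t - p t0) f \<noteq> 0" if "t \<in> {u..w}" "t \<noteq> t0" for t
      proof -
        have "0 < \<bar>t - t0\<bar>" "\<bar>t - t0\<bar> \<le> \<delta>" using that e by (auto simp: u_def w_def)
        then show ?thesis using sgn[of t f] \<open>f \<in> {d, d'}\<close> t0T by auto
      qed
      ultimately show ?thesis
        using winding_number_subpath_local[OF p uw01(1) e(5,6) uw01(2), of f] t0T by auto
    qed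
    have jump: "?L d - ?L d' = of_bool (cross (p w - x) d > 0) - of_bool (cross (p w - x) d' > 0)"
    proof (rule Ln_jump)
      have "cross (p w - x) f > 0 \<and> cross (p u - x) f < 0 \<or> cross (p w - x) f < 0 \<and> cross (p u - x) f > 0"
        if "f \<in> {d, d'}" for f
        using sgn[of w f] sgn[of u f] that e
        by (auto simp: u_def w_def zero_less_mult_iff mult_less_0_iff)
      then show "cross (p w - x) d > 0 \<and> cross (p u - x) d < 0 \<or> cross (p w - x) d < 0 \<and> cross (p u - x) d > 0"
        "cross (p w - x) d' > 0 \<and> cross (p u - x) d' < 0 \<or> cross (p w - x) d' < 0 \<and> cross (p u - x) d' > 0"
        by auto
    qed
    have same: "cross (p w - x) f > 0 \<longleftrightarrow> cross (v t0) f > 0" if "f \<in> {d, d'}" for f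
      using sgn[of w f] that e by (auto simp: w_def zero_less_mult_iff)
    have 2: "(?W u w \<longlongrightarrow> of_bool (cross (v t0) d > 0) - of_bool (cross (v t0) d' > 0)) (at_right 0)"
      using tendsto_diff[OF lim[of d] lim[of d']] unfolding jump by (simp add: same)
    have split: "winding_number (subpath a b p) z =
        winding_number (subpath a u p) z + winding_number (subpath u w p) z + winding_number (subpath w b p) z"
      if "z \<notin> path_image p" for z
      using winding_number_subpath_combine[OF valid_path_imp_path[OF p] that, of a u w]
        winding_number_subpath_combine[OF valid_path_imp_path[OF p] that, of a w b] uw01 less.prems e by simp
    have "T = insert t0 ({t \<in> {a..u}. p t = x} \<union> {t \<in> {w..b}. p t = x})"
    proof
      show "T \<subseteq> insert t0 ({t \<in> {a..u}. p t = x} \<union> {t \<in> {w..b}. p t = x})"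
      proof
        fix t assume t: "t \<in> T"
        then have "\<not> (0 < \<bar>t - t0\<bar> \<and> \<bar>t - t0\<bar> \<le> \<delta>)" using far[of t] by (auto simp: T_def)
        then have "t = t0 \<or> t \<le> u \<or> w \<le> t" using e by (auto simp: u_def w_def)
        then show "t \<in> insert t0 ({t \<in> {a..u}. p t = x} \<union> {t \<in> {w..b}. p t = x})"
          using t by (auto simp: T_def)
      qed
    qed (use t0 e Tau Twb in auto)
    moreover have "t0 \<notin> {t \<in> {a..u}. p t = x} \<union> {t \<in> {w..b}. p t = x}" "{t \<in> {a..u}. p t = x} \<inter> {t \<in> {w..b}. p t = x} = {}"
      using e by auto
    ultimately have sum: "?S a b = ?S a u + (of_bool (cross (v t0) d > 0) - of_bool (cross (v t0) d' > 0)) + ?S w b"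
      using fin' unfolding T_def by (simp add: sum.union_disjoint)
    have "((\<lambda>s. ?W a u s + ?W u w s + ?W w b s) \<longlongrightarrow> ?S a b) (at_right 0)"
      unfolding sum by (intro tendsto_add 1 2 3)
    then show ?thesis
      by (rule Lim_transform_eventually, use avoid in eventually_elim) (simp add: split)
  qed
qed

section \<open>Parametrization of a diagram\<close>

definition flow :: "diagram \<Rightarrow> param \<Rightarrow> real \<Rightarrow> complex" where
  "flow D p t = pos D (advance p t)"

lemma advance_0 [simp]: "advance p 0 = p"
  by (simp add: advance_def)

lemma advance_advance: "advance (advance p s) t = advance p (s + t)"
  by (simp add: advance_def cis_mult mult.assoc)

lemma fst_advance [simp]: "fst (advance p t) = fst p"
  by (simp add: advance_def)

lemma advance_in_params: "p \<in> params D \<Longrightarrow> advance p t \<in> params D"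
  by (auto simp: params_def advance_def norm_mult)

lemma advance_2pi: "advance p (t + 2 * pi) = advance p t"
  by (simp add: advance_def cis_mult[symmetric])

lemma unimodular_cis:
  assumes "norm z = 1"
  obtains t where "0 \<le> t" "t < 2 * pi" "z = cis t"
  using complex_unimodular_polar[OF assms] by (metis cis.ctr)

text \<open>The start \<open>s\<close> of the period is left free: besides \<open>0\<close>, a
  window starting just before \<open>p\<close> will be needed.\<close>

lemma params_eq_advance:
  assumes "p \<in> params D" "q \<in> params D" "fst q = fst p"
  obtains t where "s \<le> t" "t < s + 2 * pi" "q = advance p t"
proof -
  have n: "norm (snd p) = 1" "norm (snd q) = 1"
    using assms by (auto simp: params_def)
  define z where "z = snd q / snd p / cis s"
  have "snd p \<noteq> 0" using n(1) by (metis norm_zero zero_neq_one)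
  have "norm z = 1" by (simp only: z_def n norm_divide norm_cis)
  obtain r where r: "0 \<le> r" "r < 2 * pi" "z = cis r"
    using unimodular_cis[OF \<open>norm z = 1\<close>] by blast
  have "snd q = snd p * (cis s * z)" using \<open>snd p \<noteq> 0\<close> by (simp add: z_def)
  then have "q = advance p (s + r)"
    using assms(3) r(3) by (simp add: advance_def prod_eq_iff cis_mult)
  then show ?thesis using that[of "s + r"] r by auto
qed

lemma advance_inj:
  assumes "p \<in> params D" "advance p s = advance p t" "\<bar>s - t\<bar> < 2 * pi"
  shows "s = t"
proof -
  have "snd p \<noteq> 0" using assms(1) by (auto simp: params_def)
  then have "cis s = cis t" using assms(2) by (simp add: advance_def)
  then have "cis (s - t) = 1" by (simp add: cis_divide[symmetric])
  then have "cos (s - t) = 1" by (metis cis.sel(1) one_complex.sel(1))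
  then obtain n :: int where "s - t = of_int n * (2 * pi)"
    using cos_one_2pi_int by auto
  with assms(3) have "\<bar>of_int n * (2 * pi)\<bar> < 2 * pi" by simp
  then have "\<bar>of_int n :: real\<bar> < 1" by (simp add: abs_mult)
  then have "n = 0" by linarith
  then show ?thesis using \<open>s - t = of_int n * (2 * pi)\<close> by simp
qed

locale link =
  fixes D :: diagram
  assumes link: "link_diagram D"
begin

abbreviation image :: "complex set" where
  "image \<equiv> pos D ` params D"

text \<open>\<open>velocity\<close> is defined pointwise, as a derivative at time 0 from each
  parameter separately. Writing \<open>p\<close> by its angle turns all of them into values of one
  continuous derivative of \<open>curve\<close>.\<close>

lemma flow_differentiable:
  assumes p: "p \<in> params D"
  shows "(flow D p has_vector_derivative velocity D (advance p t)) (at t)"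
    and "continuous_on UNIV (\<lambda>t. velocity D (advance p t))"
proof -
  have i: "fst p < ncomp D" "norm (snd p) = 1" using p by (auto simp: params_def)
  obtain \<theta> where \<theta>: "snd p = cis \<theta>"
    using unimodular_cis[OF i(2)] by blast
  let ?f = "\<lambda>t. curve D (fst p) (cis t)"
  obtain f' where f': "\<And>t. (?f has_vector_derivative f' t) (at t)" "continuous_on UNIV f'"
  proof -
    have "?f C1_differentiable_on UNIV" using link i(1) unfolding link_diagram_def by metis
    then show ?thesis using that unfolding C1_differentiable_on_def by auto
  qed
  have flow: "flow D p = (\<lambda>t. ?f (t + \<theta>))"
    by (simp add: flow_def fun_eq_iff pos_def advance_def \<theta> cis_mult add.commute)
  have shift: "(\<lambda>s. pos D (advance (advance p t) s)) = (\<lambda>s. ?f (s + (t + \<theta>)))" for t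
    unfolding fun_eq_iff advance_advance flow_def[symmetric] fun_cong[OF flow] by (simp add: add_ac)
  have der: "((\<lambda>s. ?f (s + c)) has_vector_derivative f' (t + c)) (at t)" for c t
    using vector_diff_chain_at[of "\<lambda>s. s + c" 1 t ?f "f' (t + c)"] f'(1)[of "t + c"]
    by (simp add: o_def has_vector_derivative_add_const)
  have vel: "velocity D (advance p t) = f' (t + \<theta>)" for t
    unfolding velocity_def shift using vector_derivative_at[OF der[of "t + \<theta>" 0]] by simp
  show "(flow D p has_vector_derivative velocity D (advance p t)) (at t)"
    unfolding flow vel by (rule der)
  show "continuous_on UNIV (\<lambda>t. velocity D (advance p t))"
    unfolding vel by (intro continuous_on_compose2[OF f'(2)] continuous_intros) auto
qed

lemma continuous_on_flow:
  assumes "p \<in> params D"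
  shows "continuous_on S (flow D p)"
proof -
  have "isCont (flow D p) t" for t
    by (rule has_vector_derivative_continuous[OF flow_differentiable(1)[OF assms]])
  then show ?thesis by (simp add: continuous_at_imp_continuous_on)
qed

lemma flow_in_image: "p \<in> params D \<Longrightarrow> flow D p t \<in> image"
  by (simp add: flow_def advance_in_params)

lemma image_eq: "image = (\<Union>i<ncomp D. flow D (i, 1) ` {0..2 * pi})"
proof
  show "image \<subseteq> (\<Union>i<ncomp D. flow D (i, 1) ` {0..2 * pi})"
  proof
    fix z assume "z \<in> image"
    then obtain q where q: "q \<in> params D" "z = pos D q" by auto
    have q1: "(fst q, 1) \<in> params D" using q by (auto simp: params_def)
    obtain t where t: "0 \<le> t" "t < 0 + 2 * pi" "q = advance (fst q, 1) t"
      using params_eq_advance[OF q1 q(1), of 0] by auto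
    then have "z = flow D (fst q, 1) t" by (simp add: flow_def q(2))
    then show "z \<in> (\<Union>i<ncomp D. flow D (i, 1) ` {0..2 * pi})"
      using q1 t by (intro UN_I[of "fst q"]) (auto simp: params_def)
  qed
next
  have "flow D (i, 1) t \<in> image" if "i < ncomp D" for i t
    using that by (intro flow_in_image) (simp add: params_def)
  then show "(\<Union>i<ncomp D. flow D (i, 1) ` {0..2 * pi}) \<subseteq> image" by blast
qed

lemma compact_image: "compact image"
  unfolding image_eq
  by (intro compact_UN compact_continuous_image continuous_on_flow) (auto simp: params_def)

section \<open>Short transverse rays and the diagram\<close>

text \<open>A strand through \<open>x\<close> stays off short rays because its displacement has
  nonzero \<open>cross\<close> with every \<open>d\<close> in \<open>K\<close>, whereas a point of
  the ray has a displacement parallel to \<open>d\<close>. A strand elsewhere keeps a positive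
  distance. Compactness of the parameter circle makes the bound uniform.\<close>

lemma rays_avoid_image:
  assumes K: "compact K"
    and nz: "\<And>p d. p \<in> params D \<Longrightarrow> pos D p = x \<Longrightarrow> d \<in> K \<Longrightarrow> cross (velocity D p) d \<noteq> 0"
  shows "\<exists>\<eta>>0. \<forall>s d. 0 < s \<and> s < \<eta> \<and> d \<in> K \<longrightarrow> x + of_real s * d \<notin> image"
proof -
  define P where "P = (\<lambda>p a b. \<exists>\<eta>>0. \<forall>t s d. a \<le> t \<and> t \<le> b \<and> 0 < s \<and> s < \<eta> \<and> d \<in> K \<longrightarrow> flow D p t \<noteq> x + of_real s * d)"
  have shift: "flow D (advance p r) t = flow D p (r + t)" for p r t
    by (simp add: flow_def advance_advance)
  have P: "\<exists>\<delta>>0. P p (- \<delta>) \<delta>" if p: "p \<in> params D" for p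
  proof (cases "pos D p = x")
    case True
    obtain \<delta> where \<delta>: "\<delta> > 0" "\<forall>t d. 0 < \<bar>t - 0\<bar> \<and> \<bar>t - 0\<bar> \<le> \<delta> \<and> d \<in> K \<longrightarrow>
           0 < cross (flow D p t - flow D p 0) d * cross (velocity D p) d * (t - 0)"
      using cross_eventually_sgn[of "flow D p" "velocity D p" 0 K] flow_differentiable(1)[OF p, of 0] K nz[OF p True]
      by auto
    have "flow D p t \<noteq> x + of_real s * d" if "- \<delta> \<le> t" "t \<le> \<delta>" "0 < s" "d \<in> K" for t s d
    proof
      assume eq: "flow D p t = x + of_real s * d"
      have fl0: "flow D p 0 = x" using True by (simp add: flow_def)
      have "d \<noteq> 0" using nz[OF p True that(4)] by (auto simp: cross_zero_right)
      then have "t \<noteq> 0" using eq fl0 that by auto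
      then have "0 < cross (flow D p t - flow D p 0) d * cross (velocity D p) d * t"
        using \<delta>(2)[rule_format, of t d] that by auto
      moreover have "cross (flow D p t - flow D p 0) d = 0"
        unfolding eq fl0 using cross_scaleR_left[of s d d] by (simp add: cross_self scaleR_conv_of_real)
      ultimately show False by simp
    qed
    then show ?thesis using \<delta>(1) unfolding P_def by (intro exI[of _ \<delta>] conjI exI[of _ 1]) auto
  next
    case False
    define r where "r = norm (pos D p - x)"
    have r: "r > 0" using False by (simp add: r_def)
    obtain M where M: "M > 0" "\<And>d. d \<in> K \<Longrightarrow> norm d \<le> M"
      using compact_imp_bounded[OF K] by (auto simp: bounded_pos)
    have "isCont (flow D p) 0" using continuous_on_flow[OF p, of UNIV] by (simp add: continuous_on_eq_continuous_at)
    then have "\<exists>\<delta>>0. \<forall>t. dist t 0 < \<delta> \<longrightarrow> dist (flow D p t) (flow D p 0) < r / 2"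
      using r half_gt_zero unfolding continuous_at_eps_delta by blast
    then obtain \<delta> where \<delta>: "\<delta> > 0" "\<And>t. \<bar>t\<bar> < \<delta> \<Longrightarrow> norm (flow D p t - flow D p 0) < r / 2"
      by (auto simp: dist_norm)
    \<comment> \<open>Ray and curve each move by less than \<open>r / 2\<close>, so they cannot
      bridge the distance \<open>r\<close> between \<open>x\<close> and
      \<open>pos D p\<close>.\<close>
    have "flow D p t \<noteq> x + of_real s * d" if "- (\<delta> / 2) \<le> t" "t \<le> \<delta> / 2" "0 < s" "s < r / (2 * M)" "d \<in> K" for t s d
    proof
      assume eq: "flow D p t = x + of_real s * d"
      have "norm (of_real s * d) \<le> s * M" using that M(2) by (simp add: norm_mult)
      also have "\<dots> < r / 2" using that(4) M(1) by (simp add: field_simps)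
      finally have "norm (flow D p t - x) < r / 2" using eq by simp
      moreover have "norm (flow D p t - flow D p 0) < r / 2" using \<delta> that by (intro \<delta>(2)) auto
      moreover have "flow D p 0 = pos D p" by (simp add: flow_def)
      ultimately show False using r_def norm_triangle_sub[of "pos D p - x" "flow D p t - x"]
        by (simp add: norm_minus_commute)
    qed
    then show ?thesis using \<delta>(1) r M(1) unfolding P_def
      by (intro exI[of _ "\<delta> / 2"] conjI exI[of _ "r / (2 * M)"]) auto
  qed
  \<comment> \<open>\<open>P\<close> passes to the union of adjacent intervals and holds on all
    short intervals around a point, which is the form that bisection requires.\<close>
  have P_all: "P (i, 1) 0 (2 * pi)" if i: "i < ncomp D" for i
  proof (rule Bolzano)
    have p: "(i, 1) \<in> params D" using i by (simp add: params_def)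
    show "P (i, 1) a c" if ab: "P (i, 1) a b" and bc: "P (i, 1) b c" for a b c
    proof -
      obtain e1 where "e1 > 0" "\<forall>t s d. a \<le> t \<and> t \<le> b \<and> 0 < s \<and> s < e1 \<and> d \<in> K \<longrightarrow> flow D (i, 1) t \<noteq> x + of_real s * d"
        using ab unfolding P_def by blast
      moreover obtain e2 where "e2 > 0" "\<forall>t s d. b \<le> t \<and> t \<le> c \<and> 0 < s \<and> s < e2 \<and> d \<in> K \<longrightarrow> flow D (i, 1) t \<noteq> x + of_real s * d"
        using bc unfolding P_def by blast
      ultimately show ?thesis unfolding P_def
        by (intro exI[of _ "min e1 e2"]) (metis linorder_le_cases min_less_iff_conj)
    qed
    show "\<exists>\<delta>>0. \<forall>a b. a \<le> t \<and> t \<le> b \<and> b - a < \<delta> \<longrightarrow> P (i, 1) a b" for t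
    proof -
      obtain \<delta> where \<delta>: "\<delta> > 0" "P (advance (i, 1) t) (- \<delta>) \<delta>"
        using P[OF advance_in_params[OF p]] by auto
      then obtain \<eta> where \<eta>: "\<eta> > 0" "\<And>r s d. - \<delta> \<le> r \<Longrightarrow> r \<le> \<delta> \<Longrightarrow> 0 < s \<Longrightarrow> s < \<eta> \<Longrightarrow> d \<in> K
           \<Longrightarrow> flow D (i, 1) (t + r) \<noteq> x + of_real s * d"
        unfolding P_def shift by auto
      have "P (i, 1) a b" if "a \<le> t" "t \<le> b" "b - a < \<delta>" for a b
        unfolding P_def
      proof (intro exI[of _ \<eta>] conjI allI impI \<eta>(1))
        fix u s d assume "a \<le> u \<and> u \<le> b \<and> 0 < s \<and> s < \<eta> \<and> d \<in> K"
        then show "flow D (i, 1) u \<noteq> x + of_real s * d"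
          using \<eta>(2)[of "u - t" s d] that by auto
      qed
      then show ?thesis using \<delta>(1) by blast
    qed
  qed auto
  have "\<forall>i. \<exists>e>0. i < ncomp D \<longrightarrow> (\<forall>t s d. 0 \<le> t \<and> t \<le> 2 * pi \<and> 0 < s \<and> s < e \<and> d \<in> K \<longrightarrow> flow D (i, 1) t \<noteq> x + of_real s * d)"
    using P_all unfolding P_def by (metis zero_less_one)
  then obtain e where e: "\<And>i. e i > 0"
      "\<And>i t s d. i < ncomp D \<Longrightarrow> 0 \<le> t \<Longrightarrow> t \<le> 2 * pi \<Longrightarrow> 0 < s \<Longrightarrow> s < e i \<Longrightarrow> d \<in> K \<Longrightarrow> flow D (i, 1) t \<noteq> x + of_real s * d"
    by metis
  show ?thesis
  \<comment> \<open>The inserted \<open>1\<close> keeps the minimum meaningful for a diagram without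
    components.\<close>
  proof (intro exI[of _ "Min (insert 1 (e ` {..<ncomp D}))"] conjI allI impI)
    show "Min (insert 1 (e ` {..<ncomp D})) > 0" using e(1) by auto
    fix s d assume s: "0 < s \<and> s < Min (insert 1 (e ` {..<ncomp D})) \<and> d \<in> K"
    then have "flow D (i, 1) t \<noteq> x + of_real s * d" if "i < ncomp D" "t \<in> {0..2 * pi}" for i t
      using that by (intro e(2)) auto
    then show "x + of_real s * d \<notin> image" unfolding image_eq by fastforce
  qed
qed

section \<open>Regions and their winding numbers\<close>

lemma regions_iff: "R \<in> regions D \<longleftrightarrow> R \<in> components (- image)"
  by (simp add: regions_def)

lemma region_disjoint_image: "R \<in> regions D \<Longrightarrow> R \<inter> image = {}"
  using in_components_subset unfolding regions_iff by blast

lemma regions_eqI: "R \<in> regions D \<Longrightarrow> R' \<in> regions D \<Longrightarrow> z \<in> R \<Longrightarrow> z \<in> R' \<Longrightarrow> R = R'"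
  using components_nonoverlap unfolding regions_iff by blast

lemma region_at:
  assumes "z \<notin> image" obtains R where "R \<in> regions D" "z \<in> R"
  using assms Union_components[of "- image"] unfolding regions_def by blast

lemma connected_subset_region:
  assumes "R \<in> regions D" "connected A" "A \<inter> image = {}" "R \<inter> A \<noteq> {}"
  shows "A \<subseteq> R"
  using assms components_maximal[of R "- image" A] unfolding regions_iff by blast

lemma open_region: "R \<in> regions D \<Longrightarrow> open R"
  unfolding regions_def using compact_image open_components compact_imp_closed by blast

lemma region_towards_eqI:
  assumes R: "R \<in> regions D" "S \<noteq> {}" "\<And>d. d \<in> S \<Longrightarrow> \<forall>\<^sub>F s in at_right 0. x + of_real s * d \<in> R"
  shows "region_towards D x S = R"
  unfolding region_towards_def
proof (rule the_equality)
  fix R' assume R': "R' \<in> regions D \<and> (\<forall>d\<in>S. \<forall>\<^sub>F s in at_right 0. x + of_real s * d \<in> R')"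
  obtain d where "d \<in> S" using R(2) by auto
  then have "\<forall>\<^sub>F s in at_right (0::real). x + of_real s * d \<in> R \<and> x + of_real s * d \<in> R'"
    using R' R(3) by (auto intro: eventually_conj)
  then obtain s where "x + of_real s * d \<in> R \<and> x + of_real s * d \<in> R'"
    using eventually_happens trivial_limit_at_right_real by blast
  then show "R' = R" using R' R(1) regions_eqI by blast
qed (use R in auto)

text \<open>\<open>S\<close> need not be compact, so each \<open>d\<close> gets its own bound
  \<open>\<eta> d\<close>, taken uniformly over the segment from a fixed \<open>d0\<close> to
  \<open>d\<close>. The truncated cone \<open>A d\<close> over this segment is connected and misses
  the diagram, and all these cones meet along the ray of \<open>d0\<close>.\<close>

lemma sector_region:
  assumes S: "convex S" "S \<noteq> {}"
    and nz: "\<And>p d. p \<in> params D \<Longrightarrow> pos D p = x \<Longrightarrow> d \<in> S \<Longrightarrow> cross (velocity D p) d \<noteq> 0"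
  obtains R where "R \<in> regions D" "\<And>d. d \<in> S \<Longrightarrow> \<forall>\<^sub>F s in at_right 0. x + of_real s * d \<in> R"
proof -
  obtain d0 where d0: "d0 \<in> S" using S by auto
  have "\<exists>\<eta>>0. \<forall>s e. 0 < s \<and> s < \<eta> \<and> e \<in> closed_segment d0 d \<longrightarrow> x + of_real s * e \<notin> image" if "d \<in> S" for d
  proof (rule rays_avoid_image)
    fix p e assume "p \<in> params D" "pos D p = x" "e \<in> closed_segment d0 d"
    then show "cross (velocity D p) e \<noteq> 0"
      using nz[of p e] closed_segment_subset[OF d0 that S(1)] by auto
  qed simp
  then obtain \<eta> where \<eta>: "\<And>d. d \<in> S \<Longrightarrow> \<eta> d > 0"
      "\<And>d s e. d \<in> S \<Longrightarrow> 0 < s \<Longrightarrow> s < \<eta> d \<Longrightarrow> e \<in> closed_segment d0 d \<Longrightarrow> x + of_real s * e \<notin> image"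
    by metis
  define A where "A = (\<lambda>d. (\<lambda>(s, e). x + of_real s * e) ` ({0<..<\<eta> d} \<times> closed_segment d0 d))"
  have conn: "connected (A d)" for d
    unfolding A_def
    by (intro connected_continuous_image connected_Times)
       (auto intro!: continuous_intros simp: case_prod_unfold)
  have disj: "A d \<inter> image = {}" if "d \<in> S" for d
  proof -
    have "x + of_real s * e \<notin> image" if "s \<in> {0<..<\<eta> d}" "e \<in> closed_segment d0 d" for s e
      using \<eta>(2)[OF \<open>d \<in> S\<close>, of s e] that by simp
    then show ?thesis unfolding A_def by (auto simp del: image_iff) blast
  qed
  have in_A: "x + of_real s * e \<in> A d" if "0 < s" "s < \<eta> d" "e \<in> {d0, d}" for s d e
    using that unfolding A_def by (auto intro!: image_eqI[of _ _ "(s, e)"])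
  define s0 where "s0 = \<eta> d0 / 2"
  have s0: "0 < s0" "s0 < \<eta> d0" using \<eta>(1)[OF d0] by (auto simp: s0_def)
  then have "x + of_real s0 * d0 \<in> A d0" by (intro in_A) auto
  then obtain R where R: "R \<in> regions D" "x + of_real s0 * d0 \<in> R"
    using disj[OF d0] region_at by blast
  have AR: "A d0 \<subseteq> R"
    using R \<open>x + of_real s0 * d0 \<in> A d0\<close> by (intro connected_subset_region conn disj d0) auto
  have "\<forall>\<^sub>F s in at_right 0. x + of_real s * d \<in> R" if d: "d \<in> S" for d
  proof -
    define s where "s = min (\<eta> d) (\<eta> d0) / 2"
    have s: "0 < s" "s < \<eta> d" "s < \<eta> d0" using \<eta>(1)[OF d] \<eta>(1)[OF d0] by (auto simp: s_def)
    have "x + of_real s * d0 \<in> A d" "x + of_real s * d0 \<in> A d0" using s by (auto intro: in_A)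
    then have "A d \<subseteq> R" using AR by (intro connected_subset_region R conn disj d) auto
    then show ?thesis
      using \<eta>(1)[OF d] in_A[of _ d d] unfolding eventually_at_right_field by blast
  qed
  with R(1) show ?thesis by (rule that)
qed

lemma finite_preimages: "finite {p \<in> params D. pos D p = x}"
proof (rule ccontr)
  let ?P = "{p \<in> params D. pos D p = x}"
  assume "infinite ?P"
  then obtain B where "B \<subseteq> ?P" "finite B" "card B = 3"
    using infinite_arbitrarily_large by blast
  then obtain p q r where "p \<in> ?P" "q \<in> ?P" "r \<in> ?P" "p \<noteq> q" "q \<noteq> r" "p \<noteq> r"
    unfolding card_3_iff by auto
  moreover from this have "pos D p = pos D q" "pos D q = pos D r" by auto
  moreover have "\<forall>p\<in>params D. \<forall>q\<in>params D. \<forall>r\<in>params D.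
        pos D p = pos D q \<and> pos D q = pos D r \<longrightarrow> p = q \<or> q = r \<or> p = r"
    using link unfolding link_diagram_def by metis
  ultimately show False by blast
qed

section \<open>The total winding number of the link\<close>

definition loop :: "nat \<Rightarrow> real \<Rightarrow> complex" where
  "loop i t = flow D (i, 1) (2 * pi * t)"

definition winding :: "complex \<Rightarrow> complex" where
  "winding z = (\<Sum>i<ncomp D. winding_number (loop i) z)"

lemma flow_scaled_derivative:
  assumes "p \<in> params D"
  shows "((\<lambda>t. flow D p (2 * pi * t)) has_vector_derivative
          (2 * pi) *\<^sub>R velocity D (advance p (2 * pi * t))) (at t)"
proof -
  have "((\<lambda>t. 2 * pi * t) has_vector_derivative 2 * pi) (at t)"
    by (auto intro!: derivative_eq_intros)
  from vector_diff_chain_at[OF this flow_differentiable(1)[OF assms]] show ?thesis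
    by (simp add: o_def)
qed

lemma valid_path_flow:
  assumes "p \<in> params D"
  shows "valid_path (\<lambda>t. flow D p (2 * pi * t))"
  unfolding valid_path_def
proof (rule C1_differentiable_imp_piecewise)
  have "continuous_on {0..1} (\<lambda>t. (2 * pi) *\<^sub>R velocity D (advance p (2 * pi * t)))"
    by (intro continuous_intros continuous_on_compose2[OF flow_differentiable(2)[OF assms]]) auto
  then show "(\<lambda>t. flow D p (2 * pi * t)) C1_differentiable_on {0..1}"
    unfolding C1_differentiable_on_def using flow_scaled_derivative[OF assms]
    by (intro exI[of _ "\<lambda>t. (2 * pi) *\<^sub>R velocity D (advance p (2 * pi * t))"]) auto
qed

lemma flow_2pi: "flow D p (t + 2 * pi) = flow D p t"
  by (simp add: flow_def advance_2pi)

context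
  fixes i assumes i: "i < ncomp D"
begin

lemma base_in_params: "(i, 1) \<in> params D"
  using i by (simp add: params_def)

lemma valid_path_loop: "valid_path (loop i)"
  unfolding loop_def using valid_path_flow[OF base_in_params] by simp

lemma closed_loop: "pathfinish (loop i) = pathstart (loop i)"
  using flow_2pi[of "(i, 1)" 0] by (simp add: loop_def pathfinish_def pathstart_def)

lemma loop_subset_image: "path_image (loop i) \<subseteq> image"
  using flow_in_image[OF base_in_params] by (auto simp: path_image_def loop_def)

text \<open>The jump formula for subpaths excludes endpoints at \<open>x\<close>, but the base point
  of \<open>loop i\<close> may lie there. The closed loop is therefore rotated to a base point
  \<open>c\<close> off \<open>x\<close>, which changes no winding number off the diagram.\<close>

lemma winding_loop_jump:
  assumes avoid: "\<forall>\<^sub>F s in at_right 0. x + of_real s * d \<notin> image"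
               "\<forall>\<^sub>F s in at_right 0. x + of_real s * d' \<notin> image"
    and nz: "\<And>p. p \<in> params D \<Longrightarrow> pos D p = x \<Longrightarrow> cross (velocity D p) d \<noteq> 0 \<and> cross (velocity D p) d' \<noteq> 0"
  shows "((\<lambda>s. winding_number (loop i) (x + of_real s * d) - winding_number (loop i) (x + of_real s * d')) \<longlongrightarrow>
    (\<Sum>p | p \<in> params D \<and> fst p = i \<and> pos D p = x.
        of_bool (cross (velocity D p) d > 0) - of_bool (cross (velocity D p) d' > 0))) (at_right 0)"
proof -
  let ?P = "{p. p \<in> params D \<and> fst p = i \<and> pos D p = x}"
  have finP: "finite ?P" by (rule finite_subset[OF _ finite_preimages[of x]]) auto
  \<comment> \<open>Infinitely many base points are available and only finitely many lie over
    \<open>x\<close>.\<close>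
  have "infinite ((\<lambda>a. advance (i, 1) (2 * pi * a)) ` {0..<1})"
  proof
    assume "finite ((\<lambda>a. advance (i, 1) (2 * pi * a)) ` {0..<1::real})"
    moreover have "inj_on (\<lambda>a. advance (i, 1) (2 * pi * a)) {0..<1}"
    proof (rule inj_onI)
      fix a b :: real
      assume ab: "a \<in> {0..<1}" "b \<in> {0..<1}" "advance (i, 1) (2 * pi * a) = advance (i, 1) (2 * pi * b)"
      have "\<bar>2 * pi * a - 2 * pi * b\<bar> = 2 * pi * \<bar>a - b\<bar>"
        by (simp add: abs_mult right_diff_distrib[symmetric])
      also have "\<dots> < 2 * pi * 1" using ab by (intro mult_strict_left_mono) auto
      finally have "2 * pi * a = 2 * pi * b"
        using advance_inj[OF base_in_params ab(3)] by simp
      then show "a = b" by simp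
    qed
    ultimately have "finite {0..<1::real}" by (rule finite_imageD)
    then show False by (simp add: infinite_Ico)
  qed
  then obtain a where a: "a \<in> {0..<1}" "advance (i, 1) (2 * pi * a) \<notin> ?P"
    using finP by (meson finite_subset image_subsetI)
  define c where "c = advance (i, 1) (2 * pi * a)"
  have c: "c \<in> params D" "fst c = i" "pos D c \<noteq> x"
    using a(2) advance_in_params[OF base_in_params] by (auto simp: c_def)
  define q where "q = (\<lambda>t. flow D c (2 * pi * t))"
  have q_shift: "q = shiftpath a (loop i)"
  proof
    fix t
    have "q t = flow D (i, 1) (2 * pi * (a + t))"
      by (simp add: q_def c_def flow_def advance_advance distrib_left)
    moreover have "flow D (i, 1) (2 * pi * (a + t)) = flow D (i, 1) (2 * pi * (a + t - 1))"
      using flow_2pi[of "(i, 1)" "2 * pi * (a + t - 1)"] by (simp add: algebra_simps)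
    ultimately show "q t = shiftpath a (loop i) t"
      by (simp add: shiftpath_def loop_def)
  qed
  have q_image: "path_image q \<subseteq> image"
    using flow_in_image[OF c(1)] by (auto simp: path_image_def q_def)
  have wn: "winding_number (loop i) z = winding_number q z" if "z \<notin> image" for z
    unfolding q_shift
    by (rule winding_number_shiftpath[symmetric, OF valid_path_imp_path[OF valid_path_loop]])
       (use loop_subset_image closed_loop that a(1) in auto)
  let ?T = "{t \<in> {0..1}. q t = x}"
  let ?adv = "\<lambda>t. advance c (2 * pi * t)"
  have q_end: "q 0 \<noteq> x" "q 1 \<noteq> x"
    using c(3) flow_2pi[of c 0] by (auto simp: q_def flow_def)
  \<comment> \<open>Times 0 and 1 give the same parameter, but \<open>q_end\<close> excludes both,
    so each passage is counted once although the interval is closed.\<close>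
  have bij: "bij_betw ?adv ?T ?P"
    unfolding bij_betw_def
  proof
    show "inj_on ?adv ?T"
    proof (rule inj_onI)
      fix s t assume st: "s \<in> ?T" "t \<in> ?T" "?adv s = ?adv t"
      then have "\<bar>s - t\<bar> < 1" using q_end by (smt (verit) atLeastAtMost_iff mem_Collect_eq)
      have "\<bar>2 * pi * s - 2 * pi * t\<bar> = 2 * pi * \<bar>s - t\<bar>"
        by (simp add: abs_mult right_diff_distrib[symmetric])
      also have "\<dots> < 2 * pi * 1" using \<open>\<bar>s - t\<bar> < 1\<close> by (intro mult_strict_left_mono) auto
      finally show "s = t" using advance_inj[OF c(1) st(3)] by simp
    qed
    show "?adv ` ?T = ?P"
    proof
      show "?adv ` ?T \<subseteq> ?P" using advance_in_params[OF c(1)] c(2) by (auto simp: q_def flow_def)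
      show "?P \<subseteq> ?adv ` ?T"
      proof
        fix p assume p: "p \<in> ?P"
        then obtain t where t: "0 \<le> t" "t < 0 + 2 * pi" "p = advance c t"
          using params_eq_advance[OF c(1), of p 0] c(2) by auto
        have "q (t / (2 * pi)) = x" "t / (2 * pi) \<in> {0..1}" "?adv (t / (2 * pi)) = p"
          using p t by (auto simp: q_def flow_def)
        then show "p \<in> ?adv ` ?T" by (intro image_eqI[of _ _ "t / (2 * pi)"]) auto
      qed
    qed
  qed
  have finT: "finite ?T" using bij_betw_finite[OF bij] finP by simp
  let ?v = "\<lambda>t. (2 * pi) *\<^sub>R velocity D (?adv t)"
  have cross_v: "cross (?v t) e = 2 * pi * cross (velocity D (?adv t)) e" for t e
    by (rule cross_scaleR_left)
  have "((\<lambda>s. winding_number (subpath 0 1 q) (x + of_real s * d) -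
               winding_number (subpath 0 1 q) (x + of_real s * d')) \<longlongrightarrow>
      (\<Sum>t | t \<in> {0..1} \<and> q t = x. of_bool (cross (?v t) d > 0) - of_bool (cross (?v t) d' > 0))) (at_right 0)"
  proof (rule winding_number_subpath_jump[OF _ order_refl q_end(2) _ _ order_refl zero_le_one q_end(1) finT])
    show "valid_path q" unfolding q_def by (rule valid_path_flow[OF c(1)])
    show "\<forall>\<^sub>F s in at_right 0. x + of_real s * d \<notin> path_image q"
      using avoid(1) by eventually_elim (use q_image in auto)
    show "\<forall>\<^sub>F s in at_right 0. x + of_real s * d' \<notin> path_image q"
      using avoid(2) by eventually_elim (use q_image in auto)
    show "(q has_vector_derivative ?v t) (at t)" for t
      unfolding q_def by (rule flow_scaled_derivative[OF c(1)])
    show "cross (?v t) d \<noteq> 0 \<and> cross (?v t) d' \<noteq> 0" if "q t = x" for t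
      using nz[OF advance_in_params[OF c(1)], of "2 * pi * t"] that unfolding cross_v
      by (simp add: q_def flow_def)
  qed
  also have "(\<Sum>t | t \<in> {0..1} \<and> q t = x. of_bool (cross (?v t) d > 0) - of_bool (cross (?v t) d' > 0))
    = (\<Sum>p\<in>?P. of_bool (cross (velocity D p) d > 0) - of_bool (cross (velocity D p) d' > 0) :: complex)"
    unfolding cross_v
    by (subst sum.reindex_bij_betw[OF bij, symmetric]) (simp add: zero_less_mult_iff)
  finally show ?thesis
    by (rule Lim_transform_eventually, use avoid in eventually_elim) (simp add: wn)
qed

end

lemma winding_jump:
  assumes avoid: "\<forall>\<^sub>F s in at_right 0. x + of_real s * d \<notin> image"
               "\<forall>\<^sub>F s in at_right 0. x + of_real s * d' \<notin> image"
    and nz: "\<And>p. p \<in> params D \<Longrightarrow> pos D p = x \<Longrightarrow> cross (velocity D p) d \<noteq> 0 \<and> cross (velocity D p) d' \<noteq> 0"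
  shows "((\<lambda>s. winding (x + of_real s * d) - winding (x + of_real s * d')) \<longlongrightarrow>
    (\<Sum>p | p \<in> params D \<and> pos D p = x.
        of_bool (cross (velocity D p) d > 0) - of_bool (cross (velocity D p) d' > 0))) (at_right 0)"
proof -
  let ?h = "\<lambda>p. of_bool (cross (velocity D p) d > 0) - of_bool (cross (velocity D p) d' > 0) :: complex"
  have "(\<Sum>p | p \<in> params D \<and> pos D p = x. ?h p) =
      (\<Sum>i<ncomp D. \<Sum>p | p \<in> {p. p \<in> params D \<and> pos D p = x} \<and> fst p = i. ?h p)"
    using finite_preimages[of x] by (intro sum.group[symmetric]) (auto simp: params_def)
  also have "\<dots> = (\<Sum>i<ncomp D. \<Sum>p | p \<in> params D \<and> fst p = i \<and> pos D p = x. ?h p)"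
    by (intro sum.cong) auto
  finally have eq: "(\<Sum>p | p \<in> params D \<and> pos D p = x. ?h p) = \<dots>" .
  show ?thesis
    unfolding winding_def sum_subtractf[symmetric] eq
    by (intro tendsto_sum winding_loop_jump avoid nz) auto
qed

lemma winding_in_Ints: "z \<notin> image \<Longrightarrow> winding z \<in> \<int>"
  unfolding winding_def
  using loop_subset_image valid_path_loop closed_loop
  by (intro Ints_sum integer_winding_number valid_path_imp_path) auto

lemma winding_region_eq:
  assumes "R \<in> regions D" "z \<in> R" "w \<in> R"
  shows "winding z = winding w"
  unfolding winding_def
proof (rule sum.cong)
  fix i assume "i \<in> {..<ncomp D}"
  then show "winding_number (loop i) z = winding_number (loop i) w"
    using assms loop_subset_image[of i] region_disjoint_image[OF assms(1)]
    by (intro winding_number_eq[OF valid_path_imp_path[OF valid_path_loop] closed_loop, of _ _ R])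
       (auto simp: regions_def intro: in_components_connected)
qed simp

text \<open>Meaningful for regions only, where the winding number is constant and an integer; an
  integer value gives access to parity.\<close>

definition index :: "complex set \<Rightarrow> int" where
  "index R = (SOME n. \<forall>z\<in>R. winding z = of_int n)"

lemma winding_eq_index:
  assumes R: "R \<in> regions D" and z: "z \<in> R"
  shows "winding z = of_int (index R)"
proof -
  have "z \<notin> image" using region_disjoint_image[OF R] z by auto
  then obtain n where "winding z = of_int n" using winding_in_Ints Ints_cases by metis
  then have "\<forall>w\<in>R. winding w = of_int n" using winding_region_eq[OF R _ z] by auto
  then have "\<forall>w\<in>R. winding w = of_int (index R)" unfolding index_def by (rule someI)
  then show ?thesis using z by blast
qed

text \<open>Along the two rays the difference of winding numbers is eventually constant, so it
  equals the limit that \<open>winding_jump\<close> computes.\<close>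

lemma index_jump:
  assumes R: "R \<in> regions D" "\<forall>\<^sub>F s in at_right 0. x + of_real s * d \<in> R"
    and R': "R' \<in> regions D" "\<forall>\<^sub>F s in at_right 0. x + of_real s * d' \<in> R'"
    and nz: "\<And>p. p \<in> params D \<Longrightarrow> pos D p = x \<Longrightarrow> cross (velocity D p) d \<noteq> 0 \<and> cross (velocity D p) d' \<noteq> 0"
  shows "index R - index R' = (\<Sum>p | p \<in> params D \<and> pos D p = x.
        of_bool (cross (velocity D p) d > 0) - of_bool (cross (velocity D p) d' > 0))" (is "_ = ?s")
proof -
  have "\<forall>\<^sub>F s in at_right 0. x + of_real s * d \<notin> image"
    using R(2) by eventually_elim (use region_disjoint_image[OF R(1)] in auto)
  moreover have "\<forall>\<^sub>F s in at_right 0. x + of_real s * d' \<notin> image"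
    using R'(2) by eventually_elim (use region_disjoint_image[OF R'(1)] in auto)
  ultimately have "((\<lambda>s. winding (x + of_real s * d) - winding (x + of_real s * d')) \<longlongrightarrow>
    (\<Sum>p | p \<in> params D \<and> pos D p = x.
        of_bool (cross (velocity D p) d > 0) - of_bool (cross (velocity D p) d' > 0))) (at_right 0)"
    using nz by (rule winding_jump)
  then have "((\<lambda>s::real. of_int (index R - index R')) \<longlongrightarrow> (of_int ?s :: complex)) (at_right 0)"
    unfolding of_int_sum of_int_diff of_int_of_bool
    by (rule Lim_transform_eventually, use R(2) R'(2) in eventually_elim)
       (simp add: winding_eq_index[OF R(1)] winding_eq_index[OF R'(1)])
  then have "of_int (index R - index R') = (of_int ?s :: complex)"
    by (simp only: tendsto_const_iff trivial_limit_at_right_real not_False_eq_True)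
  then show ?thesis by (simp only: of_int_eq_iff)
qed

lemma exterior_region: "exterior_region D \<in> regions D" "\<not> bounded (exterior_region D)"
proof -
  have b: "bounded (- (- image))" using compact_image by (simp add: compact_imp_bounded)
  have "\<exists>!R. R \<in> regions D \<and> \<not> bounded R"
    using cobounded_unbounded_components[OF b] cobounded_unique_unbounded_components[OF b]
    unfolding regions_def by (metis DIM_complex order_refl)
  from theI'[OF this] show "exterior_region D \<in> regions D" "\<not> bounded (exterior_region D)"
    by (auto simp: exterior_region_def)
qed

lemma index_exterior: "index (exterior_region D) = 0"
proof -
  have "\<forall>i. \<exists>B. i < ncomp D \<longrightarrow> (\<forall>z. B \<le> norm z \<longrightarrow> winding_number (loop i) z = 0)"
    using winding_number_zero_at_infinity[OF valid_path_imp_path[OF valid_path_loop] closed_loop] by blast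
  then obtain B where B: "\<And>i z. i < ncomp D \<Longrightarrow> B i \<le> norm z \<Longrightarrow> winding_number (loop i) z = 0"
    by metis
  \<comment> \<open>The inserted \<open>0\<close> covers the empty diagram.\<close>
  obtain z where z: "z \<in> exterior_region D" "norm z > Max (insert 0 (B ` {..<ncomp D}))"
    using exterior_region(2) unfolding bounded_iff by (meson not_le)
  have "B i \<le> norm z" if "i < ncomp D" for i
    using z(2) that by (auto intro: less_imp_le)
  then have "winding z = 0" unfolding winding_def by (intro sum.neutral) (auto intro: B)
  then show ?thesis using winding_eq_index[OF exterior_region(1) z(1)] by simp
qed

end

section \<open>Regions at simple points\<close>

lemma convex_cross_less: "convex {d. cross u d < 0}"
proof (rule convexI)
  fix x y a b :: _
  assume *: "x \<in> {d. cross u d < 0}" "y \<in> {d. cross u d < 0}" "0 \<le> (a::real)" "0 \<le> b" "a + b = 1"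
  then have "a * cross u x + b * cross u y < 0"
    using convex_bound_lt[of "cross u x" 0 "cross u y" a b] by simp
  then show "a *\<^sub>R x + b *\<^sub>R y \<in> {d. cross u d < 0}"
    by (simp add: cross_add_right cross_scaleR_right)
qed

lemma convex_cross_greater: "convex {d. cross u d > 0}"
  using convex_cross_less[of "- u"] by (simp add: cross_minus_left)

lemma cross_rotate: "cross u (cis t * u) = sin t * (norm u)\<^sup>2"
  unfolding cmod_power2 by (simp add: cross_def power2_eq_square algebra_simps)

lemma cross_ii: "cross u (\<i> * u) = (norm u)\<^sup>2"
  unfolding cmod_power2 by (simp add: cross_def power2_eq_square)

lemma swept_nonempty:
  assumes "cross u v \<noteq> 0"
  shows "swept u v \<noteq> {}"
proof -
  have "continuous_on UNIV (\<lambda>t. cross (cis t * u) v)" by (intro continuous_intros)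
  then have "isCont (\<lambda>t. cross (cis t * u) v) 0" by (simp add: continuous_on_eq_continuous_at)
  then obtain e where e: "e > 0" "\<And>t. \<bar>t\<bar> < e \<Longrightarrow> cross (cis t * u) v \<noteq> 0"
    using continuous_at_avoid[of 0 "\<lambda>t. cross (cis t * u) v" 0] assms by (auto simp: dist_real_def)
  then have "cis (e / 2) * u \<in> swept u v"
    unfolding swept_def by (intro CollectI exI[of _ "e / 2"]) auto
  then show ?thesis by auto
qed

text \<open>This places the swept directions in an intersection of two open half-planes, a convex
  set as needed by \<open>sector_region\<close>: left of \<open>u\<close>, and on the same side of
  the line of \<open>v\<close> as \<open>u\<close>. The second holds by the intermediate value
  theorem, since the rotating ray never becomes parallel to \<open>v\<close>. The first holds since
  the angle stays below pi: a half turn would end at \<open>- u\<close>, on the other side of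
  \<open>v\<close>.\<close>

lemma swept_subset:
  assumes c: "cross u v \<noteq> 0"
  shows "swept u v \<subseteq> {d. cross u d > 0} \<inter> {d. cross (- cross u v *\<^sub>R v) d > 0}"
proof
  fix d assume "d \<in> swept u v"
  then obtain t where t: "d = cis t * u" "t > 0" "\<And>s. 0 < s \<Longrightarrow> s \<le> t \<Longrightarrow> cross (cis s * u) v \<noteq> 0"
    unfolding swept_def by (smt (verit) greaterThanAtMost_iff mem_Collect_eq)
  let ?h = "\<lambda>s. cross (cis s * u) v * cross u v"
  have nz: "?h s \<noteq> 0" if "0 \<le> s" "s \<le> t" for s
    using t(3)[of s] that c by (cases "s = 0") auto
  have cont: "continuous_on {0..s} ?h" for s by (intro continuous_intros)
  have pos: "?h s > 0" if s: "0 \<le> s" "s \<le> t" for s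
  proof (rule ccontr)
    assume "\<not> ?h s > 0"
    then have "\<exists>r\<ge>0. r \<le> s \<and> ?h r = 0"
      using s c by (intro IVT2' cont) auto
    then show False using nz s by auto
  qed
  have "t < pi"
  proof (rule ccontr)
    assume "\<not> t < pi"
    then have "?h pi > 0" by (intro pos) auto
    then show False using zero_le_square[of "cross u v"] by (simp add: cross_minus_left)
  qed
  have "u \<noteq> 0" using c by (auto simp: cross_zero_left)
  then have "cross u d > 0" using t(1,2) \<open>t < pi\<close> by (simp add: cross_rotate sin_gt_zero)
  moreover have "cross (- cross u v *\<^sub>R v) d > 0"
    using pos[of t] t(1,2) cross_commute[of "cis t * u" v] cross_scaleR_left[of "- cross u v" v d]
    by (simp add: mult.commute)
  ultimately show "d \<in> {d. cross u d > 0} \<inter> {d. cross (- cross u v *\<^sub>R v) d > 0}" by simp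
qed

context link
begin

lemma velocity_nonzero: "p \<in> params D \<Longrightarrow> velocity D p \<noteq> 0"
  using link unfolding link_diagram_def by metis

text \<open>One direction already determines a region, so \<open>T\<close> may be any nonempty part
  of the convex sector; this admits the swept sets, whose convexity is never established.\<close>

lemma sector_towards:
  assumes "convex S" "T \<subseteq> S" "T \<noteq> {}"
    and "\<And>p d. p \<in> params D \<Longrightarrow> pos D p = x \<Longrightarrow> d \<in> S \<Longrightarrow> cross (velocity D p) d \<noteq> 0"
  shows "region_towards D x T \<in> regions D"
    and "\<And>d. d \<in> S \<Longrightarrow> \<forall>\<^sub>F s in at_right 0. x + of_real s * d \<in> region_towards D x T"
proof -
  have "S \<noteq> {}" using assms by auto
  then obtain R where R: "R \<in> regions D" "\<And>d. d \<in> S \<Longrightarrow> \<forall>\<^sub>F s in at_right 0. x + of_real s * d \<in> R"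
    using sector_region[of S x] assms by metis
  moreover have "region_towards D x T = R"
    using R assms(2,3) by (intro region_towards_eqI) auto
  ultimately show "region_towards D x T \<in> regions D"
    "\<And>d. d \<in> S \<Longrightarrow> \<forall>\<^sub>F s in at_right 0. x + of_real s * d \<in> region_towards D x T"
    by auto
qed

context
  fixes p assumes p: "p \<in> simple_params D"
begin

lemma simple_in_params: "p \<in> params D"
  and simple_unique: "q \<in> params D \<Longrightarrow> pos D q = pos D p \<Longrightarrow> q = p"
  using p by (auto simp: simple_params_def)

lemma ii_velocity: "cross (velocity D p) (\<i> * velocity D p) > 0"
  using velocity_nonzero[OF simple_in_params] by (simp add: cross_ii)

lemma left_region:
  shows "left_region D p \<in> regions D"
    and "\<And>d. cross (velocity D p) d > 0 \<Longrightarrow> \<forall>\<^sub>F s in at_right 0. pos D p + of_real s * d \<in> left_region D p"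
proof -
  have ne: "{d. cross (velocity D p) d > 0} \<noteq> {}" using ii_velocity by auto
  show "left_region D p \<in> regions D"
    "\<And>d. cross (velocity D p) d > 0 \<Longrightarrow> \<forall>\<^sub>F s in at_right 0. pos D p + of_real s * d \<in> left_region D p"
    using sector_towards[OF convex_cross_greater order_refl ne, of "pos D p"] simple_unique
    unfolding left_region_def by force+
qed

lemma right_region:
  shows "right_region D p \<in> regions D"
    and "\<And>d. cross (velocity D p) d < 0 \<Longrightarrow> \<forall>\<^sub>F s in at_right 0. pos D p + of_real s * d \<in> right_region D p"
proof -
  have "cross (velocity D p) (- (\<i> * velocity D p)) < 0" using ii_velocity by (simp add: cross_minus_right)
  then have ne: "{d. cross (velocity D p) d < 0} \<noteq> {}" by blast
  show "right_region D p \<in> regions D"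
    "\<And>d. cross (velocity D p) d < 0 \<Longrightarrow> \<forall>\<^sub>F s in at_right 0. pos D p + of_real s * d \<in> right_region D p"
    using sector_towards[OF convex_cross_less order_refl ne, of "pos D p"] simple_unique
    unfolding right_region_def by force+
qed

lemma index_left_right: "index (left_region D p) = index (right_region D p) + 1"
proof -
  let ?v = "velocity D p" and ?d = "\<i> * velocity D p"
  have d: "cross ?v ?d > 0" "cross ?v (- ?d) < 0"
    using ii_velocity by (simp_all add: cross_minus_right)
  have pre: "{q. q \<in> params D \<and> pos D q = pos D p} = {p}"
    using simple_in_params simple_unique by auto
  have "index (left_region D p) - index (right_region D p) =
     (\<Sum>q | q \<in> params D \<and> pos D q = pos D p.
        of_bool (cross (velocity D q) ?d > 0) - of_bool (cross (velocity D q) (- ?d) > 0))"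
    using left_region right_region d simple_unique
    by (intro index_jump[of _ "pos D p" ?d _ "- ?d"]) fastforce+
  also have "\<dots> = 1" unfolding pre using d by simp
  finally show ?thesis by simp
qed

section \<open>The complement of the diagram near a simple point\<close>

text \<open>The rest of the link, \<open>C\<close>, is compact and does not contain the simple
  point, hence stays at a positive distance from it.\<close>

lemma simple_locality:
  assumes "0 < \<delta>" "\<delta> < pi"
  shows "\<exists>e>0. \<forall>q\<in>params D. pos D q \<in> ball (pos D p) e \<longrightarrow> (\<exists>t. \<bar>t\<bar> < \<delta> \<and> q = advance p t)"
proof -
  define C where "C = (\<Union>i\<in>{..<ncomp D} - {fst p}. flow D (i, 1) ` {0..2 * pi}) \<union> flow D p ` {\<delta>..2 * pi - \<delta>}"
  have "compact C"
    unfolding C_def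
    by (intro compact_Un compact_UN compact_continuous_image continuous_on_flow simple_in_params)
       (auto simp: params_def)
  have C: "pos D q \<in> C" if q: "q \<in> params D" and n: "\<nexists>t. \<bar>t\<bar> < \<delta> \<and> q = advance p t" for q
  proof (cases "fst q = fst p")
    case True
    obtain t where t: "- \<delta> \<le> t" "t < - \<delta> + 2 * pi" "q = advance p t"
      using params_eq_advance[OF simple_in_params q True, of "- \<delta>"] by auto
    have "\<not> \<bar>t\<bar> < \<delta>" using n t(3) by blast
    \<comment> \<open>The half-open window includes the time \<open>- \<delta>\<close>, which
      belongs to \<open>C\<close> only as its periodic copy
      \<open>2 * pi - \<delta>\<close>.\<close>
    then have "t = - \<delta> \<or> \<delta> \<le> t" using t(1) by linarith
    then have "q = advance p (if t = - \<delta> then 2 * pi - \<delta> else t)"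
      "(if t = - \<delta> then 2 * pi - \<delta> else t) \<in> {\<delta>..2 * pi - \<delta>}"
      using t assms advance_2pi[of p "- \<delta>"] by auto
    then show ?thesis unfolding C_def flow_def by blast
  next
    case False
    have q1: "(fst q, 1) \<in> params D" using q by (auto simp: params_def)
    obtain t where t: "0 \<le> t" "t < 0 + 2 * pi" "q = advance (fst q, 1) t"
      using params_eq_advance[OF q1 q, of 0] by auto
    then have "pos D q = flow D (fst q, 1) t" by (simp add: flow_def)
    then have "pos D q \<in> flow D (fst q, 1) ` {0..2 * pi}" using t by auto
    moreover have "fst q \<in> {..<ncomp D} - {fst p}" using False q by (auto simp: params_def)
    ultimately show ?thesis unfolding C_def by blast
  qed
  have "pos D p \<notin> C"
  proof
    assume "pos D p \<in> C"
    then consider i t where "i < ncomp D" "i \<noteq> fst p" "pos D p = flow D (i, 1) t"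
      | t where "\<delta> \<le> t" "t \<le> 2 * pi - \<delta>" "pos D p = flow D p t"
      unfolding C_def by auto
    then show False
    proof cases
      case (1 i t)
      have "advance (i, 1) t \<in> params D" using 1 by (intro advance_in_params) (auto simp: params_def)
      then have "advance (i, 1) t = p" using 1 by (intro simple_unique) (auto simp: flow_def)
      then show False using 1 fst_advance[of "(i, 1)" t] by simp
    next
      case (2 t)
      then have "advance p t = advance p 0"
        using simple_unique[OF advance_in_params[OF simple_in_params], of t] by (simp add: flow_def)
      then show False using advance_inj[OF simple_in_params, of t 0] 2 assms by auto
    qed
  qed
  then obtain e where e: "e > 0" "ball (pos D p) e \<subseteq> - C"
    using compact_imp_closed[OF \<open>compact C\<close>] open_contains_ball[of "- C"] by auto
  show ?thesis using e C by (intro exI[of _ e]) blast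
qed

text \<open>\<open>Re (cnj v * z)\<close> is the inner product of \<open>v\<close> and
  \<open>z\<close>. Along the curve its derivative at 0 is the squared speed, and continuity of the
  velocity keeps it positive nearby.\<close>

lemma flow_increasing:
  "\<exists>\<delta>>0. \<forall>s t. - \<delta> < s \<longrightarrow> s < t \<longrightarrow> t < \<delta> \<longrightarrow>
     Re (cnj (velocity D p) * flow D p s) < Re (cnj (velocity D p) * flow D p t)"
proof -
  let ?v = "velocity D p"
  let ?h = "\<lambda>t. Re (cnj ?v * flow D p t)" and ?h' = "\<lambda>t. Re (cnj ?v * velocity D (advance p t))"
  have "continuous_on UNIV ?h'"
    by (intro continuous_intros flow_differentiable(2) simple_in_params)
  then have "open {t. 0 < ?h' t}" by (intro open_Collect_less continuous_on_const)
  moreover have "?h' 0 = (norm ?v)\<^sup>2" unfolding cmod_power2 by (simp add: power2_eq_square)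
  then have "?h' 0 > 0" using velocity_nonzero[OF simple_in_params] by simp
  ultimately obtain \<delta> where \<delta>: "\<delta> > 0" "ball 0 \<delta> \<subseteq> {t. 0 < ?h' t}"
    by (auto elim!: openE)
  have der: "(?h has_real_derivative ?h' t) (at t)" for t
  proof -
    have "((\<lambda>t. cnj ?v * flow D p t) has_vector_derivative cnj ?v * velocity D (advance p t)) (at t)"
      by (intro has_vector_derivative_mult_right flow_differentiable(1) simple_in_params)
    then show ?thesis
      unfolding has_real_derivative_iff_has_vector_derivative
      by (rule bounded_linear.has_vector_derivative[OF bounded_linear_Re])
  qed
  have "?h s < ?h t" if "- \<delta> < s" "s < t" "t < \<delta>" for s t
    using that(2)
  proof (rule DERIV_pos_imp_increasing)
    fix r assume "s \<le> r" "r \<le> t"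
    then show "\<exists>y. (?h has_real_derivative y) (at r) \<and> y > 0"
      using der subsetD[OF \<delta>(2), of r] that by (intro exI[of _ "?h' r"]) auto
  qed
  then show ?thesis using \<delta>(1) by blast
qed

text \<open>Rays from the point do not settle this, as their bounds need not be uniform near the
  tangent. Instead a nearby \<open>z\<close> is written as \<open>flow D p t\<close> plus a normal
  vector, with \<open>t\<close> found by the intermediate value theorem for the tangential
  coordinate \<open>h\<close>; the sign of the normal coordinate \<open>r\<close> then decides
  between left and right.\<close>

lemma regions_near_simple:
  "\<exists>e>0. \<forall>z\<in>ball (pos D p) e. z \<notin> image \<longrightarrow> z \<in> left_region D p \<union> right_region D p"
proof -
  define x v where "x = pos D p" and "v = velocity D p"
  let ?f = "flow D p"
  have f0: "?f 0 = x" by (simp add: flow_def x_def)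
  have v: "v \<noteq> 0" using velocity_nonzero[OF simple_in_params] by (simp add: v_def)
  define h where "h = (\<lambda>z. Re (cnj v * z))"
  have h_diff: "h (y - z) = h y - h z" for y z by (simp add: h_def algebra_simps)
  have h_add: "h (y + z) = h y + h z" for y z by (simp add: h_def algebra_simps)
  have h_normal: "h (of_real r * (\<i> * v)) = 0" for r by (simp add: h_def)
  obtain \<delta>' where \<delta>': "\<delta>' > 0" "\<And>s t. - \<delta>' < s \<Longrightarrow> s < t \<Longrightarrow> t < \<delta>' \<Longrightarrow> h (?f s) < h (?f t)"
    using flow_increasing unfolding h_def v_def by blast
  \<comment> \<open>Capping at 1 keeps \<open>\<delta>\<close> below pi, as
    \<open>simple_locality\<close> demands.\<close>
  define \<delta> where "\<delta> = min \<delta>' 1"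
  have \<delta>: "0 < \<delta>" "\<delta> < pi" "\<And>s t. - \<delta> < s \<Longrightarrow> s < t \<Longrightarrow> t < \<delta> \<Longrightarrow> h (?f s) < h (?f t)"
    using \<delta>' pi_gt3 by (auto simp: \<delta>_def)
  obtain e where e: "e > 0" "\<And>q. q \<in> params D \<Longrightarrow> pos D q \<in> ball x e \<Longrightarrow> \<exists>t. \<bar>t\<bar> < \<delta> \<and> q = advance p t"
    using simple_locality[OF \<delta>(1,2)] unfolding x_def by blast
  have "isCont ?f 0" using continuous_on_flow[OF simple_in_params, of UNIV] by (simp add: continuous_on_eq_continuous_at)
  then have "\<exists>\<delta>>0. \<forall>t. dist t 0 < \<delta> \<longrightarrow> dist (?f t) (?f 0) < e / 4"
    using e(1) unfolding continuous_at_eps_delta by (metis zero_less_divide_iff zero_less_numeral)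
  then obtain \<delta>'' where \<delta>'': "\<delta>'' > 0" "\<And>t. \<bar>t\<bar> < \<delta>'' \<Longrightarrow> norm (?f t - x) < e / 4"
    by (auto simp: dist_norm f0)
  define a where "a = min \<delta> \<delta>'' / 2"
  have a: "0 < a" "a < \<delta>" "\<And>t. \<bar>t\<bar> \<le> a \<Longrightarrow> norm (?f t - x) < e / 4"
    using \<delta>(1) \<delta>'' by (auto simp: a_def)
  \<comment> \<open>Normal segments get length below \<open>e / 2\<close>. Together with the
    \<open>e / 4\<close> by which the curve may move they remain in the ball of radius
    \<open>e\<close>, and conversely a point within \<open>e / 4\<close> of \<open>x\<close> has
    normal coordinate below \<open>\<eta>\<close>.\<close>
  define \<eta> where "\<eta> = e / (2 * norm v)"
  have \<eta>: "\<eta> > 0" using e v by (simp add: \<eta>_def)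
  \<comment> \<open>A diagram point there would be some \<open>?f s\<close> with \<open>s\<close>
    near 0 and the same value of \<open>h\<close>; strict monotonicity gives \<open>s = t\<close>,
    hence \<open>r = 0\<close>.\<close>
  have off: "?f t + of_real r * (\<i> * v) \<notin> image" if t: "\<bar>t\<bar> \<le> a" and r: "r \<noteq> 0" "\<bar>r\<bar> < \<eta>" for t r
  proof
    assume "?f t + of_real r * (\<i> * v) \<in> image"
    then obtain q where q: "q \<in> params D" "pos D q = ?f t + of_real r * (\<i> * v)" by auto
    have "norm (of_real r * (\<i> * v)) < e / 2"
      using r v by (simp add: norm_mult \<eta>_def field_simps)
    moreover have "norm (?f t - x) < e / 4" using a(3) t by simp
    ultimately have "norm ((?f t - x) + of_real r * (\<i> * v)) < e"
      using e(1) norm_triangle_ineq[of "?f t - x" "of_real r * (\<i> * v)"] by linarith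
    then have "pos D q \<in> ball x e"
      by (simp add: q(2) dist_norm norm_minus_commute algebra_simps)
    then obtain s where s: "\<bar>s\<bar> < \<delta>" "q = advance p s" using e(2) q(1) by blast
    then have eq: "?f s = ?f t + of_real r * (\<i> * v)" using q(2) by (simp add: flow_def)
    then have "h (?f s) = h (?f t)" by (simp add: h_add h_normal del: of_real_mult)
    moreover have "- \<delta> < s" "s < \<delta>" "- \<delta> < t" "t < \<delta>" using s(1) t a(2) by linarith+
    ultimately have "s = t" using \<delta>(3)[of s t] \<delta>(3)[of t s] by (cases s t rule: linorder_cases) auto
    then show False using eq r v by simp
  qed
  have half: "?f t + of_real r * (\<i> * v) \<in> R"
    if t: "\<bar>t\<bar> \<le> a" and r: "r \<noteq> 0" "\<bar>r\<bar> < \<eta>" and R: "R \<in> regions D"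
      and ev: "\<forall>\<^sub>F s in at_right 0. x + of_real s * (of_real (sgn r) * (\<i> * v)) \<in> R" for t r R
  proof -
    \<comment> \<open>a strip along one side of the curve, swept by normal segments that never meet the curve again\<close>
    define H where "H = (\<lambda>(t, s). ?f t + of_real s * (of_real (sgn r) * (\<i> * v))) ` ({-a..a} \<times> {0<..<\<eta>})"
    have "connected H"
      unfolding H_def case_prod_unfold
      by (intro connected_continuous_image connected_Times continuous_intros
          continuous_on_compose2[OF continuous_on_flow[OF simple_in_params, of UNIV]]) auto
    moreover have "H \<inter> image = {}"
    proof -
      have "?f t + of_real s * (of_real (sgn r) * (\<i> * v)) \<notin> image" if "t \<in> {-a..a}" "s \<in> {0<..<\<eta>}" for t s
      proof -
        have "\<bar>t\<bar> \<le> a" "s * sgn r \<noteq> 0" "\<bar>s * sgn r\<bar> < \<eta>"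
          using that r(1) by (auto simp: abs_mult sgn_if)
        from off[OF this] show ?thesis by (simp add: mult.assoc)
      qed
      then show ?thesis unfolding H_def by (auto simp del: image_iff) blast
    qed
    moreover have "R \<inter> H \<noteq> {}"
    proof -
      have "\<forall>\<^sub>F s in at_right 0. s \<in> {0<..<\<eta>}" using \<eta> by (rule eventually_at_right_real)
      with ev have "\<forall>\<^sub>F s in at_right 0. s \<in> {0<..<\<eta>} \<and> x + of_real s * (of_real (sgn r) * (\<i> * v)) \<in> R"
        by eventually_elim simp
      then obtain s where s: "s \<in> {0<..<\<eta>}" "x + of_real s * (of_real (sgn r) * (\<i> * v)) \<in> R"
        using eventually_happens trivial_limit_at_right_real by blast
      then have "x + of_real s * (of_real (sgn r) * (\<i> * v)) \<in> H"
        unfolding H_def using a(1) f0 by (intro image_eqI[of _ _ "(0, s)"]) auto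
      then show ?thesis using s(2) by blast
    qed
    ultimately have "H \<subseteq> R" by (intro connected_subset_region R)
    moreover have "?f t + of_real r * (\<i> * v) \<in> H"
    proof -
      have "of_real r * (\<i> * v) = of_real \<bar>r\<bar> * (of_real (sgn r) * (\<i> * v))"
        by (simp add: sgn_if)
      then show ?thesis unfolding H_def using t r by (intro image_eqI[of _ _ "(t, \<bar>r\<bar>)"]) auto
    qed
    ultimately show ?thesis by auto
  qed
  have mono: "h (?f (- a)) < h x" "h x < h (?f a)"
    using \<delta>(3)[of "- a" 0] \<delta>(3)[of 0 a] a f0 by auto
  have "continuous_on UNIV h" unfolding h_def by (intro continuous_intros)
  then have "open ({z. h (?f (- a)) < h z} \<inter> {z. h z < h (?f a)})"
    by (intro open_Int open_Collect_less continuous_on_const)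
  then obtain b where b: "b > 0" "\<And>z. dist z x < b \<Longrightarrow> h (?f (- a)) < h z \<and> h z < h (?f a)"
    using mono unfolding open_dist by blast
  show ?thesis
  proof (intro exI[of _ "min b (e / 4)"] conjI ballI impI)
    show "min b (e / 4) > 0" using b e by simp
    fix z assume "z \<in> ball (pos D p) (min b (e / 4))" and nz: "z \<notin> image"
    then have z: "dist z x < b" "norm (z - x) < e / 4" by (auto simp: x_def dist_commute dist_norm norm_minus_commute)
    have "\<exists>t\<ge>-a. t \<le> a \<and> h (?f t) = h z"
      using b(2)[OF z(1)] a(1) unfolding h_def
      by (intro IVT' continuous_intros continuous_on_flow simple_in_params) auto
    then obtain t where t: "\<bar>t\<bar> \<le> a" "h (?f t) = h z" by (metis abs_le_iff minus_le_iff)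
    \<comment> \<open>By the choice of \<open>t\<close>, \<open>cnj v * (z - ?f t)\<close> is purely
      imaginary, so \<open>z - ?f t\<close> is a real multiple of \<open>\<i> * v\<close>.\<close>
    define r where "r = Im (cnj v * (z - ?f t)) / (norm v)\<^sup>2"
    have "Re (cnj v * (z - ?f t)) = 0" using t(2) h_diff[of z "?f t"] by (simp add: h_def)
    then have "cnj v * (z - ?f t) = of_real (r * (norm v)\<^sup>2) * \<i>"
      using v by (simp add: complex_eq_iff r_def)
    also have "\<dots> = cnj v * (of_real r * (\<i> * v))"
      by (simp add: complex_norm_square[symmetric] complex_mult_cnj mult_ac flip: of_real_power)
    finally have "z - ?f t = of_real r * (\<i> * v)" using v by (subst (asm) mult_left_cancel) auto
    then have zr: "z = ?f t + of_real r * (\<i> * v)" by (metis add.commute diff_add_cancel)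
    then have "r \<noteq> 0" using nz flow_in_image[OF simple_in_params, of t] by auto
    have "norm (z - ?f t) < e / 2"
      using norm_triangle_ineq4[of "z - x" "?f t - x"] z(2) a(3)[OF t(1)] by simp
    then have "\<bar>r\<bar> < \<eta>" using v unfolding zr \<eta>_def by (simp add: norm_mult field_simps)
    show "z \<in> left_region D p \<union> right_region D p"
    proof (cases "r > 0")
      case True
      then have "z \<in> left_region D p"
        unfolding zr using left_region ii_velocity \<open>\<bar>r\<bar> < \<eta>\<close> t(1)
        by (intro half) (auto simp: x_def v_def)
      then show ?thesis ..
    next
      case False
      then have sgn: "sgn r = - 1" using \<open>r \<noteq> 0\<close> by simp
      have "cross (velocity D p) (- (\<i> * velocity D p)) < 0" using ii_velocity by (simp add: cross_minus_right)
      from right_region(2)[OF this] have "z \<in> right_region D p"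
        unfolding zr using right_region(1) \<open>\<bar>r\<bar> < \<eta>\<close> \<open>r \<noteq> 0\<close> t(1) sgn
        by (intro half) (auto simp: x_def v_def)
      then show ?thesis ..
    qed
  qed
qed

end

section \<open>The checkerboard coloring\<close>

definition odd_regions :: "complex set set" where
  "odd_regions = {R \<in> regions D. odd (index R)}"

lemma checkerboard_odd_regions: "checkerboard D odd_regions"
  unfolding checkerboard_def odd_regions_def
  by (auto simp: index_exterior index_left_right left_region(1) right_region(1))

lemma finite_multiple_points: "finite (pos D ` (params D - simple_params D))"
proof (rule finite_subset)
  show "pos D ` (params D - simple_params D) \<subseteq> (\<lambda>x. pos D (fst x)) ` crossings D"
  proof
    fix z assume "z \<in> pos D ` (params D - simple_params D)"
    then obtain p q where pq: "p \<in> params D" "q \<in> params D" "p \<noteq> q" "pos D p = pos D q" "z = pos D p"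
      unfolding simple_params_def by fastforce
    then have "p \<in> under D \<longleftrightarrow> q \<notin> under D" using link unfolding link_diagram_def by metis
    then have "(p, q) \<in> crossings D \<or> (q, p) \<in> crossings D"
      using pq unfolding crossings_def by auto
    then show "z \<in> (\<lambda>x. pos D (fst x)) ` crossings D"
      using pq by (auto intro: rev_image_eqI)
  qed
  show "finite ((\<lambda>x. pos D (fst x)) ` crossings D)"
    using link unfolding link_diagram_def by blast
qed

lemma checkerboard_unique:
  assumes B1: "checkerboard D B1" and B2: "checkerboard D B2"
  shows "B1 = B2"
proof (rule ccontr)
  assume neq: "B1 \<noteq> B2"
  define same where "same = (\<lambda>R. R \<in> B1 \<longleftrightarrow> R \<in> B2)"
  define E N where "E = \<Union>{R \<in> regions D. same R}" and "N = \<Union>{R \<in> regions D. \<not> same R}"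
  define X where "X = - (pos D ` (params D - simple_params D))"
  have lr: "same (left_region D p) \<longleftrightarrow> same (right_region D p)" if "p \<in> simple_params D" for p
    using B1 B2 that unfolding checkerboard_def same_def by blast
  have image_compl: "- image \<subseteq> X" by (auto simp: X_def)
  have EN: "z \<in> E \<or> z \<in> N" if "z \<notin> image" for z
    using region_at[OF that] unfolding E_def N_def by blast
  have nonempty: "R \<noteq> {}" "R \<subseteq> X" if "R \<in> regions D" for R
    using that region_disjoint_image[OF that] image_compl in_components_nonempty unfolding regions_def by blast+
  \<comment> \<open>Off the diagram a neighbourhood lies in just one of \<open>E\<close> and
    \<open>N\<close>, so their closures are disjoint within \<open>X\<close>. The closure clause
    makes these closures cover \<open>X\<close>, including the simple points of the diagram.\<close>
  have near: "\<exists>U. open U \<and> z \<in> U \<and> (U - image \<subseteq> E \<or> U - image \<subseteq> N) \<and> z \<in> closure (U - image)"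
    if z: "z \<in> X" for z
  proof (cases "z \<in> image")
    case False
    then obtain R where R: "R \<in> regions D" "z \<in> R" by (rule region_at)
    then have "R - image = R" using region_disjoint_image by blast
    moreover have "R \<subseteq> E \<or> R \<subseteq> N" using R unfolding E_def N_def by blast
    ultimately show ?thesis using R open_region[OF R(1)] closure_subset by (intro exI[of _ R]) auto
  next
    case True
    then obtain p where p: "p \<in> simple_params D" "z = pos D p" using z by (auto simp: X_def)
    obtain e where e: "e > 0" "\<And>w. w \<in> ball z e \<Longrightarrow> w \<notin> image \<Longrightarrow> w \<in> left_region D p \<union> right_region D p"
      using regions_near_simple[OF p(1)] unfolding p(2) by blast
    have "left_region D p \<union> right_region D p \<subseteq> (if same (left_region D p) then E else N)"
      using lr[OF p(1)] left_region(1)[OF p(1)] right_region(1)[OF p(1)] unfolding E_def N_def by auto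
    moreover have "ball z e - image \<subseteq> left_region D p \<union> right_region D p"
      using e(2) by blast
    ultimately have "ball z e - image \<subseteq> (if same (left_region D p) then E else N)"
      by (rule order_trans[rotated])
    then have "ball z e - image \<subseteq> E \<or> ball z e - image \<subseteq> N"
      by (cases "same (left_region D p)") simp_all
    moreover have "z \<in> closure (ball z e - image)"
    proof -
      let ?r = "\<lambda>s. z + of_real s * (\<i> * velocity D p)"
      have "\<forall>\<^sub>F s in at_right 0. ?r s \<in> left_region D p"
        unfolding p(2) using left_region(2)[OF p(1) ii_velocity[OF p(1)]] by simp
      moreover have "\<forall>\<^sub>F s in at_right 0. ?r s \<in> ball z e"
        by (rule topological_tendstoD[OF tendsto_ray open_ball]) (use e(1) in simp)
      ultimately have "\<forall>\<^sub>F s in at_right 0. ?r s \<in> ball z e - image"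
        by eventually_elim (use region_disjoint_image[OF left_region(1)[OF p(1)]] in auto)
      then have "\<forall>\<^sub>F s in at_right 0. ?r s \<in> closure (ball z e - image)"
        by eventually_elim (use closure_subset in blast)
      then show ?thesis
        by (rule Lim_in_closed_set[OF closed_closure _ trivial_limit_at_right_real tendsto_ray])
    qed
    ultimately show ?thesis using e(1) by (intro exI[of _ "ball z e"]) auto
  qed
  have disj: "E \<inter> N = {}"
    using regions_eqI unfolding E_def N_def by blast
  have "connected X"
    using connected_open_delete_finite[OF open_UNIV connected_UNIV _ finite_multiple_points]
    unfolding X_def by (simp add: Compl_eq_Diff_UNIV)
  moreover have "X \<subseteq> closure E \<union> closure N"
    using near closure_mono by blast
  moreover have "closure E \<inter> closure N \<inter> X = {}"
  proof -
    have False if z: "z \<in> closure E" "z \<in> closure N" "z \<in> X" for z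
    proof -
      obtain U where U: "open U" "z \<in> U" "U - image \<subseteq> E \<or> U - image \<subseteq> N"
        using near[OF z(3)] by blast
      have "E \<inter> image = {}" "N \<inter> image = {}"
        using region_disjoint_image unfolding E_def N_def by blast+
      then have "U \<inter> N = {} \<or> U \<inter> E = {}" using U(3) disj by blast
      then have "U \<inter> closure N = {} \<or> U \<inter> closure E = {}"
        using open_Int_closure_eq_empty[OF U(1)] by blast
      then show False using z U(2) by blast
    qed
    then show ?thesis by blast
  qed
  moreover have "closure E \<inter> X \<noteq> {}"
  proof -
    have "same (exterior_region D)" using B1 B2 unfolding same_def checkerboard_def by blast
    then have "exterior_region D \<subseteq> E" using exterior_region(1) unfolding E_def by blast
    then show ?thesis using nonempty[OF exterior_region(1)] closure_subset by blast
  qed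
  moreover have "closure N \<inter> X \<noteq> {}"
  proof -
    obtain R where "R \<in> regions D" "\<not> same R"
      using neq B1 B2 unfolding checkerboard_def same_def by blast
    then have "R \<subseteq> N" "R \<noteq> {}" "R \<subseteq> X" using nonempty unfolding N_def by blast+
    then show ?thesis using closure_subset by blast
  qed
  ultimately show False
    unfolding connected_closed by (meson closed_closure)
qed

lemma black_regions_eq: "black_regions D = odd_regions"
  unfolding black_regions_def
  by (rule the_equality) (use checkerboard_odd_regions checkerboard_unique in auto)

section \<open>The regions around a crossing\<close>

text \<open>Relative to the source region, for \<open>c > 0\<close> each swept region lies left of
  exactly one strand, so both indices are larger by 1. For \<open>c < 0\<close> one lies left of
  both strands and the other of neither, giving 2 and 0. In either case the two have equal parity,
  so failing to be both black means being both white, in accordance with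
  \<open>pos_sign\<close>.\<close>

lemma crossing_regions:
  assumes x: "(p, q) \<in> crossings D"
  defines "c \<equiv> cross (velocity D p) (velocity D q)"
  shows "c \<noteq> 0"
    and "source_region D (p, q) \<in> regions D"
    and "swept_regions D (p, q) \<subseteq> black_regions D \<longleftrightarrow> (c > 0 \<longleftrightarrow> even (index (source_region D (p, q))))"
proof -
  define u v where "u = velocity D p" and "v = velocity D q"
  have pq: "p \<in> params D" "q \<in> params D" "p \<noteq> q" "pos D p = pos D q"
    using x by (auto simp: crossings_def)
  have three: "\<forall>p\<in>params D. \<forall>q\<in>params D. \<forall>r\<in>params D.
      pos D p = pos D q \<and> pos D q = pos D r \<longrightarrow> p = q \<or> q = r \<or> p = r"
    using link unfolding link_diagram_def by metis
  have "r = p \<or> r = q" if "r \<in> params D" "pos D r = pos D p" for r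
    using three[rule_format, OF pq(1,2) that(1)] pq(3,4) that(2) by metis
  then have pre: "{r. r \<in> params D \<and> pos D r = pos D p} = {p, q}"
    using pq by auto
  show c: "c \<noteq> 0"
    unfolding c_def using link pq unfolding link_diagram_def by metis
  have c_uv: "c = cross u v" by (simp add: c_def u_def v_def)
  have uv: "velocity D r \<in> {u, v}" if "r \<in> params D" "pos D r = pos D p" for r
    using that pre by (auto simp: u_def v_def)
  define S where "S = {d. cross u d < 0} \<inter> {d. cross v d < 0}"
  define T where "T = (\<lambda>w. {d. cross w d > 0} \<inter> {d. cross (- cross w v *\<^sub>R v) d > 0})"
  \<comment> \<open>Its \<open>cross\<close> with \<open>u\<close> and with \<open>v\<close> is -1
    in both cases, whatever the sign of \<open>c\<close>.\<close>
  have "(1 / c) *\<^sub>R (u - v) \<in> S"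
    using c cross_add_right[of u u "- v"] cross_add_right[of v u "- v"] cross_commute[of v u]
    by (simp add: S_def cross_scaleR_right cross_self cross_minus_right c_uv)
  then obtain d0 where d0: "d0 \<in> S" by blast
  have S: "convex S" "\<And>d. d \<in> S \<Longrightarrow> cross u d < 0 \<and> cross v d < 0"
    by (auto simp: S_def intro!: convex_Int convex_cross_less)
  have S_eq: "source_region D (p, q) = region_towards D (pos D p) S"
    by (simp add: S_def u_def v_def Collect_conj_eq)
  have Snz: "cross (velocity D r) d \<noteq> 0" if "r \<in> params D" "pos D r = pos D p" "d \<in> S" for r d
    using uv[OF that(1,2)] S(2)[OF that(3)] by auto
  have "S \<noteq> {}" using d0 by blast
  have source: "source_region D (p, q) \<in> regions D"
    "\<forall>\<^sub>F s in at_right 0. pos D p + of_real s * d0 \<in> source_region D (p, q)"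
    unfolding S_eq
    using sector_towards[OF S(1) order_refl \<open>S \<noteq> {}\<close>, of "pos D p"] Snz d0 by blast+
  show "source_region D (p, q) \<in> regions D" by (rule source(1))
  have swept: "region_towards D (pos D p) (swept w v) \<in> regions D \<and>
      index (region_towards D (pos D p) (swept w v)) =
        index (source_region D (p, q)) + of_bool (w = u) + of_bool (cross w v < 0)"
    if w: "w \<in> {u, - u}" for w
  proof -
    have cw: "cross w v \<noteq> 0" using w c by (auto simp: c_uv cross_minus_left)
    have u0: "u \<noteq> 0" using c by (auto simp: c_uv cross_zero_left)
    have Tnz: "cross (velocity D r) d \<noteq> 0" if "r \<in> params D" "pos D r = pos D p" "d \<in> T w" for r d
      using uv[OF that(1,2)] that(3) w cw
      by (auto simp: T_def cross_minus_left cross_scaleR_left)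
    have T: "convex (T w)" "swept w v \<subseteq> T w" "swept w v \<noteq> {}"
      using swept_nonempty[OF cw] swept_subset[OF cw]
      by (auto simp: T_def intro!: convex_Int convex_cross_greater)
    obtain d1 where d1: "d1 \<in> T w" using T by blast
    have R: "region_towards D (pos D p) (swept w v) \<in> regions D"
      "\<forall>\<^sub>F s in at_right 0. pos D p + of_real s * d1 \<in> region_towards D (pos D p) (swept w v)"
      using sector_towards[OF T, of "pos D p"] Tnz d1 by blast+
    have "index (region_towards D (pos D p) (swept w v)) - index (source_region D (p, q)) =
       (\<Sum>r | r \<in> params D \<and> pos D r = pos D p.
          of_bool (cross (velocity D r) d1 > 0) - of_bool (cross (velocity D r) d0 > 0))"
      using Tnz[OF _ _ d1] Snz[OF _ _ d0] by (intro index_jump R source) simp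
    also have "\<dots> = of_bool (cross u d1 > 0) + of_bool (cross v d1 > 0)"
      unfolding pre using pq(3) S(2)[OF d0] by (simp add: u_def v_def)
    also have "cross u d1 > 0 \<longleftrightarrow> w = u"
      using w d1 u0 by (auto simp: T_def cross_minus_left)
    also have "cross v d1 > 0 \<longleftrightarrow> cross w v < 0"
      using d1 cw by (auto simp: T_def cross_minus_left cross_scaleR_left mult_less_0_iff)
    finally show ?thesis using R by simp
  qed
  \<comment> \<open>This evaluates \<open>of_bool (w = u)\<close> as 0 for the sector swept from
    \<open>- u\<close>.\<close>
  have "- u \<noteq> u" using c by (auto simp: c_uv cross_zero_left)
  then show "swept_regions D (p, q) \<subseteq> black_regions D \<longleftrightarrow> (c > 0 \<longleftrightarrow> even (index (source_region D (p, q))))"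
    using swept[of u] swept[of "- u"] c
    unfolding black_regions_eq odd_regions_def swept_regions.simps u_def[symmetric] v_def[symmetric]
    by (auto simp: c_uv cross_minus_left)
qed

section \<open>Shadow colorings and weights\<close>

text \<open>Restricted to regions because shadow colorings are extensional; only then is it unique
  as a function.\<close>

definition parity_coloring :: "complex set \<Rightarrow> bit" where
  "parity_coloring = (\<lambda>R\<in>regions D. of_bool (odd (index R)))"

lemma parity_coloring_region: "R \<in> regions D \<Longrightarrow> parity_coloring R = of_bool (odd (index R))"
  by (simp add: parity_coloring_def)

lemma positive_weight_eq_shadow_weight:
  "positive_weight \<omega> D C = shadow_weight (omega_minus_one \<omega>) D C parity_coloring"
  unfolding positive_weight_def shadow_weight_def
proof (rule sum.cong)
  fix x assume x: "x \<in> crossings D"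
  obtain p q where pq: "x = (p, q)" by (cases x)
  let ?c = "cross (velocity D p) (velocity D q)"
  have sign: "crossing_sign D x = (if ?c > 0 then 1 else - 1)" by (simp add: pq)
  note x = crossing_regions[OF x[unfolded pq], folded pq]
  show "signed (pos_sign D x) (\<omega> (C (under_arc_right D x)) (C (over_arc D x))) =
      signed (crossing_sign D x) (omega_minus_one \<omega> (parity_coloring (source_region D x))
        (C (under_arc_right D x)) (C (over_arc D x)))"
    unfolding pos_sign_def sign x(3) parity_coloring_region[OF x(2)]
    by (cases "?c > 0"; cases "even (index (source_region D x))")
       (simp_all add: signed_def omega_minus_one_def)
qed simp

text \<open>The regions colored 1 form a checkerboard coloring, so uniqueness fixes
  \<open>S\<close>. Written as an image, the index set makes
  \<open>C \<mapsto> (C, parity_coloring)\<close> the required bijection, with injectivity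
  evident.\<close>

lemma shadow_colorings_Z2:
  "{(C, S) \<in> shadow_colorings Q tri (UNIV :: bit set) Z2_act D. S (exterior_region D) = 0}
     = (\<lambda>C. (C, parity_coloring)) ` colorings Q tri D"
proof (intro equalityI subsetI)
  fix y assume "y \<in> (\<lambda>C. (C, parity_coloring)) ` colorings Q tri D"
  then show "y \<in> {(C, S) \<in> shadow_colorings Q tri (UNIV :: bit set) Z2_act D. S (exterior_region D) = 0}"
    by (auto simp: shadow_colorings_def parity_coloring_def Z2_act_def index_left_right
        left_region(1) right_region(1) exterior_region(1) index_exterior)
next
  fix y assume "y \<in> {(C, S) \<in> shadow_colorings Q tri (UNIV :: bit set) Z2_act D. S (exterior_region D) = 0}"
  then obtain C S where y: "y = (C, S)" and C: "C \<in> colorings Q tri D"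
    and S: "S \<in> extensional (regions D)" "S (exterior_region D) = 0"
      "\<And>p. p \<in> simple_params D \<Longrightarrow> S (left_region D p) = S (right_region D p) + 1"
    by (auto simp: shadow_colorings_def PiE_def Z2_act_def)
  have "checkerboard D {R \<in> regions D. S R = 1}"
    unfolding checkerboard_def using S
    by (auto simp: left_region(1) right_region(1))
  then have "{R \<in> regions D. S R = 1} = odd_regions"
    using checkerboard_unique checkerboard_odd_regions by blast
  then have "S R = 1 \<longleftrightarrow> odd (index R)" if "R \<in> regions D" for R
    using that unfolding odd_regions_def by blast
  then have "S R = parity_coloring R" if "R \<in> regions D" for R
    using that bit_not_one_iff[of "S R"]
    by (cases "odd (index R)") (simp_all add: parity_coloring_region)
  then have "S = parity_coloring"
    by (intro extensionalityI[OF S(1)]) (auto simp: parity_coloring_def)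
  then show "y \<in> (\<lambda>C. (C, parity_coloring)) ` colorings Q tri D" using y C by blast
qed

end

theorem theorem6:
  fixes Q :: "'q set"
    and tri tri_inv :: "'q \<Rightarrow> 'q \<Rightarrow> 'q"
    and \<omega> :: "'q \<Rightarrow> 'q \<Rightarrow> 'a::ab_group_add"
    and D :: diagram
  assumes "quandle Q tri tri_inv"
    and "positive_quandle_2cocycle Q tri \<omega>"
    and "link_diagram D"
  shows "same_multiset
           (colorings Q tri D)
           (\<lambda>C. positive_weight \<omega> D C)
           {(C, S) \<in> shadow_colorings Q tri (UNIV :: bit set) Z2_act D. S (exterior_region D) = 0}
           (\<lambda>(C, S). shadow_weight (omega_minus_one \<omega>) D C S)"
proof -
  interpret link D by unfold_locales (rule assms(3))
  show ?thesis
    unfolding same_multiset_def shadow_colorings_Z2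
    by (intro exI[of _ "\<lambda>C. (C, parity_coloring)"])
       (auto simp: bij_betw_def inj_on_def positive_weight_eq_shadow_weight)
qed

end
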